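(* Let $G$ be a finite group acting linearly on a finite-dimensional complex vector space $V$, and let $M$ be a quasianalytic DC-weight sequence. Let $c:(\mathbb{R},0)\to V/\!\!/G=\sigma(V)\subseteq\mathbb{C}^n$ be a germ of a $C^M$ curve. If $\bar c:(\mathbb{R},0)\to V$ is a $C^\infty$ germ with $\sigma\circ\bar c=c$, then $\bar c$ is a $C^M$ germ.
   Context: $\sigma=(\sigma_1,\dots,\sigma_n)$ for homogeneous generators $\sigma_1,\dots,\sigma_n$ of $\mathbb{C}[V]^G$; $V/\!\!/G$ is identified with $\sigma(V)\subseteq\mathbb{C}^n$. A DC-weight sequence is a non-decreasing sequence $M=(M_k)_{k\in\mathbb{N}}$ of positive reals with $M_0=1$, $M_k^2\le M_{k-1}M_{k+1}$ for $k\ge1$ and $\sup_{k\ge1}(M_{k+1}/M_k)^{1/k}<\infty$; it is quasianalytic if $\sum_{k\ge1}(k!M_k)^{-1/k}=\infty$. For $U\subseteq\mathbb{R}$ open, $C^M(U)$ consists of $f\in C^\infty(U)$ such that for every compact $K\subseteq U$ there are $C,\rho>0$ with $|f^{(k)}(x)|\le C\rho^k k!M_k$ for all $k$ and $x\in K$; complex- or vector-valued maps are $C^M$ if all real and imaginary parts of their components are. *)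

theory Defs
  imports "HOL-Analysis.Analysis" "HOL-Algebra.Group"
begin

definition linear_action ::
  "('g, 'b) monoid_scheme \<Rightarrow> ('g \<Rightarrow> complex^'d \<Rightarrow> complex^'d) \<Rightarrow> bool" where
  "linear_action G rho \<longleftrightarrow>
     group G \<and>
     (\<forall>g\<in>carrier G. \<forall>x y. rho g (x + y) = rho g x + rho g y) \<and>
     (\<forall>g\<in>carrier G. \<forall>(c::complex) x. rho g (c *s x) = c *s rho g x) \<and>
     rho \<one>\<^bsub>G\<^esub> = id \<and>
     (\<forall>g\<in>carrier G. \<forall>h\<in>carrier G. rho (g \<otimes>\<^bsub>G\<^esub> h) = rho g \<circ> rho h)"

inductive polyfun :: "(complex^'k \<Rightarrow> complex) \<Rightarrow> bool" where
  const: "polyfun (\<lambda>x. c)"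
| coord: "polyfun (\<lambda>x. x $ i)"
| add: "polyfun f \<Longrightarrow> polyfun g \<Longrightarrow> polyfun (\<lambda>x. f x + g x)"
| mult: "polyfun f \<Longrightarrow> polyfun g \<Longrightarrow> polyfun (\<lambda>x. f x * g x)"

definition homogeneous_polyfun :: "(complex^'k \<Rightarrow> complex) \<Rightarrow> bool" where
  "homogeneous_polyfun f \<longleftrightarrow> polyfun f \<and>
     (\<exists>m::nat. \<forall>(t::complex) x. f (t *s x) = t ^ m * f x)"

definition invariant_fun ::
  "('g, 'b) monoid_scheme \<Rightarrow> ('g \<Rightarrow> complex^'d \<Rightarrow> complex^'d) \<Rightarrow> (complex^'d \<Rightarrow> complex) \<Rightarrow> bool" where
  "invariant_fun G rho f \<longleftrightarrow> (\<forall>g\<in>carrier G. \<forall>x. f (rho g x) = f x)"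

definition homogeneous_generators ::
  "('g, 'b) monoid_scheme \<Rightarrow> ('g \<Rightarrow> complex^'d \<Rightarrow> complex^'d) \<Rightarrow> ('n::finite \<Rightarrow> complex^'d \<Rightarrow> complex) \<Rightarrow> bool" where
  "homogeneous_generators G rho sg \<longleftrightarrow>
     (\<forall>i. homogeneous_polyfun (sg i) \<and> invariant_fun G rho (sg i)) \<and>
     (\<forall>f. polyfun f \<and> invariant_fun G rho f \<longrightarrow>
        (\<exists>P :: complex^'n \<Rightarrow> complex. polyfun P \<and> (\<forall>x. f x = P (\<chi> i. sg i x))))"

definition orbit_map :: "('n::finite \<Rightarrow> complex^'d \<Rightarrow> complex) \<Rightarrow> complex^'d \<Rightarrow> complex^'n" where
  "orbit_map sg x = (\<chi> i. sg i x)"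

definition DC_weight_sequence :: "(nat \<Rightarrow> real) \<Rightarrow> bool" where
  "DC_weight_sequence M \<longleftrightarrow>
     (\<forall>k. 0 < M k) \<and> mono M \<and> M 0 = 1 \<and>
     (\<forall>k\<ge>1. (M k)\<^sup>2 \<le> M (k - 1) * M (k + 1)) \<and>
     (\<exists>B. \<forall>k\<ge>1. (M (k + 1) / M k) powr (1 / real k) \<le> B)"

definition quasianalytic :: "(nat \<Rightarrow> real) \<Rightarrow> bool" where
  "quasianalytic M \<longleftrightarrow>
     \<not> summable (\<lambda>k. (fact (Suc k) * M (Suc k)) powr (- 1 / real (Suc k)))"

definition C_inf_on :: "real set \<Rightarrow> (real \<Rightarrow> real) \<Rightarrow> bool" where
  "C_inf_on U f \<longleftrightarrow> (\<forall>k. \<forall>x\<in>U. ((deriv ^^ k) f) differentiable (at x))"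

definition CM_on :: "(nat \<Rightarrow> real) \<Rightarrow> real set \<Rightarrow> (real \<Rightarrow> real) \<Rightarrow> bool" where
  "CM_on M U f \<longleftrightarrow> C_inf_on U f \<and>
     (\<forall>K. compact K \<and> K \<subseteq> U \<longrightarrow>
        (\<exists>C \<rho>. C > 0 \<and> \<rho> > 0 \<and>
           (\<forall>k. \<forall>x\<in>K. \<bar>(deriv ^^ k) f x\<bar> \<le> C * \<rho> ^ k * fact k * M k)))"

definition C_inf_on_vec :: "real set \<Rightarrow> (real \<Rightarrow> complex^'k) \<Rightarrow> bool" where
  "C_inf_on_vec U f \<longleftrightarrow>
     (\<forall>i. C_inf_on U (\<lambda>t. Re (f t $ i)) \<and> C_inf_on U (\<lambda>t. Im (f t $ i)))"

definition CM_on_vec :: "(nat \<Rightarrow> real) \<Rightarrow> real set \<Rightarrow> (real \<Rightarrow> complex^'k) \<Rightarrow> bool" where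
  "CM_on_vec M U f \<longleftrightarrow>
     (\<forall>i. CM_on M U (\<lambda>t. Re (f t $ i)) \<and> CM_on M U (\<lambda>t. Im (f t $ i)))"

end

theory Submission
  imports Defs
begin

text \<open>
  Each coordinate \<open>f\<close> of \<open>cbar\<close> is a root of \<open>\<Prod>\<^sub>g (X - (g \<cdot> cbar)\<^sub>i)\<close>, whose coefficients are invariant
  polynomials evaluated along \<open>cbar\<close>, hence \<open>C\<^sup>M\<close> germs. By the Denjoy--Carleman theorem, nonzero \<open>C\<^sup>M\<close>
  germs have finite order at \<open>0\<close>; it follows that a polynomial on \<open>V\<close> whose composition with \<open>cbar\<close> is
  flat vanishes along \<open>cbar\<close> near \<open>0\<close>. Consequently a suitable \<open>X\<close>-derivative \<open>Q\<close> of the above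
  polynomial has the root \<open>f\<close> while \<open>\<partial>\<^sub>XQ(t, f)\<close> has finite order \<open>r\<close>. Newton's substitution
  \<open>f = p + t\<^sup>r\<^sup>+\<^sup>1 g\<close>, with \<open>p\<close> a Taylor polynomial, makes \<open>g\<close> a simple root of a polynomial over the
  \<open>C\<^sup>M\<close> germs; here division by \<open>t\<close> uses that \<open>C\<^sup>M\<close> is closed under derivation. A simple root solves
  a polynomial differential equation with \<open>C\<^sup>M\<close> coefficients, and for such equations the \<open>C\<^sup>M\<close> bounds
  propagate from each order of differentiation to the next.
\<close>

section \<open>Iterated derivatives of complex-valued curves\<close>

text \<open>The roots of the orbit polynomial of a coordinate may collide at \<open>0\<close>, or
  coincide identically, so no implicit function argument applies to it directly; passing to a
  derivative and Newton's shift both serve to reach a simple root. The delicate point is flatness.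
  The derivatives of the orbit polynomial, evaluated at the coordinate, are polynomials along
  \<open>cbar\<close> that are only known to be smooth, so the Denjoy-Carleman theorem says nothing
  about them. Each of them is, however, a root of its own orbit polynomial, and quasianalyticity is
  applied to the coefficients of that one. Bounds are kept uniform on a ball instead of on compact
  subsets; for germs this costs only a smaller radius, and it makes estimates with one constant
  possible.\<close>

definition ndv :: "nat \<Rightarrow> (real \<Rightarrow> complex) \<Rightarrow> real \<Rightarrow> complex" where
  "ndv k f = ((\<lambda>g t. vector_derivative g (at t)) ^^ k) f"

text \<open>Differentiability is demanded at every order, because \<open>vector_derivative\<close>
  is a total function and the iterates \<open>ndv\<close> alone carry no information.\<close>

definition smooth_curve_on :: "real set \<Rightarrow> (real \<Rightarrow> complex) \<Rightarrow> bool" where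
  "smooth_curve_on U f \<longleftrightarrow>
     (\<forall>k. \<forall>t\<in>U. (ndv k f has_vector_derivative ndv (Suc k) f t) (at t))"

lemma ndv_0 [simp]: "ndv 0 f = f"
  by (simp add: ndv_def)

lemma ndv_Suc: "ndv (Suc k) f t = vector_derivative (ndv k f) (at t)"
  by (simp add: ndv_def)

lemma ndv_Suc': "ndv (Suc k) f = ndv k (ndv (Suc 0) f)"
  unfolding ndv_def by (subst funpow_Suc_right) simp

lemma smooth_curve_onD:
  "smooth_curve_on U f \<Longrightarrow> t \<in> U \<Longrightarrow> (ndv k f has_vector_derivative ndv (Suc k) f t) (at t)"
  by (auto simp: smooth_curve_on_def)

lemma smooth_curve_on_subset:
  "smooth_curve_on U f \<Longrightarrow> V \<subseteq> U \<Longrightarrow> smooth_curve_on V f"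
  by (auto simp: smooth_curve_on_def)

lemma smooth_curve_on_continuous:
  "smooth_curve_on U f \<Longrightarrow> continuous_on U (ndv k f)"
  by (meson continuous_at_imp_continuous_on has_vector_derivative_continuous smooth_curve_onD)

text \<open>A guessed sequence \<open>D\<close> is verified by its start and its recursion only.
  Openness of \<open>U\<close> is what allows an identity at order \<open>k\<close> to be
  differentiated.\<close>

lemma ndv_jet:
  assumes U: "open U" and D0: "\<And>t. t \<in> U \<Longrightarrow> D 0 t = f t"
    and D: "\<And>k t. t \<in> U \<Longrightarrow> (D k has_vector_derivative D (Suc k) t) (at t)"
  shows "smooth_curve_on U f" and "\<And>k t. t \<in> U \<Longrightarrow> ndv k f t = D k t"
proof -
  have step: "(ndv k f has_vector_derivative D (Suc k) t) (at t)"
    if eq: "\<forall>t\<in>U. ndv k f t = D k t" and t: "t \<in> U" for k t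
    by (rule has_vector_derivative_transform_within_open[OF D[OF t] U t]) (use eq in auto)
  have *: "\<forall>t\<in>U. ndv k f t = D k t" for k
  proof (induction k)
    case (Suc k)
    then show ?case
      using step by (auto simp: ndv_Suc intro!: vector_derivative_at)
  qed (simp add: D0)
  then show "\<And>k t. t \<in> U \<Longrightarrow> ndv k f t = D k t" by blast
  show "smooth_curve_on U f"
    unfolding smooth_curve_on_def using step * by simp
qed

lemma smooth_curve_on_cong:
  assumes U: "open U" and eq: "\<And>t. t \<in> U \<Longrightarrow> f t = g t" and f: "smooth_curve_on U f"
  shows "smooth_curve_on U g" and "\<And>k t. t \<in> U \<Longrightarrow> ndv k g t = ndv k f t"
proof -
  note j = ndv_jet[of U "\<lambda>k. ndv k f" g, OF U]
  show "smooth_curve_on U g" using eq smooth_curve_onD[OF f] by (intro j) auto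
  show "\<And>k t. t \<in> U \<Longrightarrow> ndv k g t = ndv k f t"
    using eq smooth_curve_onD[OF f] by (intro j) auto
qed

lemma smooth_curve_on_ndv: "smooth_curve_on U f \<Longrightarrow> smooth_curve_on U (ndv (Suc 0) f)"
  unfolding smooth_curve_on_def by (simp flip: ndv_Suc')

lemma ndv_derivative:
  assumes U: "open U" and f: "smooth_curve_on U f"
    and g: "\<And>t. t \<in> U \<Longrightarrow> (f has_vector_derivative g t) (at t)"
  shows "smooth_curve_on U g" and "\<And>k t. t \<in> U \<Longrightarrow> ndv (Suc k) f t = ndv k g t"
proof -
  have eq: "ndv (Suc 0) f t = g t" if "t \<in> U" for t
    using g[OF that] by (simp add: ndv_Suc vector_derivative_at)
  show "smooth_curve_on U g"
    by (rule smooth_curve_on_cong(1)[OF U eq smooth_curve_on_ndv[OF f]])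
  show "ndv (Suc k) f t = ndv k g t" if "t \<in> U" for k t
    using smooth_curve_on_cong(2)[OF U eq smooth_curve_on_ndv[OF f] that, of k]
    by (simp add: ndv_Suc'[of k])
qed

lemma smooth_curve_on_const:
  assumes "open U"
  shows "smooth_curve_on U (\<lambda>t. c)"
    and "\<And>k t. t \<in> U \<Longrightarrow> ndv k (\<lambda>t. c) t = (if k = 0 then c else 0)"
proof -
  note j = ndv_jet[of U "\<lambda>k t. if k = 0 then c else 0" "\<lambda>t. c", OF assms]
  show "smooth_curve_on U (\<lambda>t. c)" by (rule j) (auto intro!: derivative_eq_intros)
  show "\<And>k t. t \<in> U \<Longrightarrow> ndv k (\<lambda>t. c) t = (if k = 0 then c else 0)"
    by (rule j) (auto intro!: derivative_eq_intros)
qed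

lemma smooth_curve_on_add:
  assumes "open U" "smooth_curve_on U f" "smooth_curve_on U g"
  shows "smooth_curve_on U (\<lambda>t. f t + g t)"
    and "\<And>k t. t \<in> U \<Longrightarrow> ndv k (\<lambda>t. f t + g t) t = ndv k f t + ndv k g t"
proof -
  note j = ndv_jet[of U "\<lambda>k t. ndv k f t + ndv k g t" "\<lambda>t. f t + g t", OF assms(1)]
  have d: "((\<lambda>t. ndv k f t + ndv k g t) has_vector_derivative ndv (Suc k) f t + ndv (Suc k) g t) (at t)"
    if "t \<in> U" for k t
    using that assms by (intro has_vector_derivative_add smooth_curve_onD)
  show "smooth_curve_on U (\<lambda>t. f t + g t)" by (rule j) (auto intro: d)
  show "\<And>k t. t \<in> U \<Longrightarrow> ndv k (\<lambda>t. f t + g t) t = ndv k f t + ndv k g t"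
    by (rule j) (auto intro: d)
qed

text \<open>Pascal's rule: the passage from order \<open>k\<close> to \<open>Suc k\<close> in the
  Leibniz formula, for bare sequences so that no analysis interferes.\<close>

lemma Leibniz_sum_Suc:
  fixes F G :: "nat \<Rightarrow> 'a :: comm_semiring_1"
  shows "(\<Sum>j\<le>k. of_nat (k choose j) * (F j * G (Suc (k - j)) + F (Suc j) * G (k - j))) =
         (\<Sum>j\<le>Suc k. of_nat (Suc k choose j) * (F j * G (Suc k - j)))"
proof -
  have "(\<Sum>j\<le>Suc k. of_nat (Suc k choose j) * (F j * G (Suc k - j))) =
      F 0 * G (Suc k) + (\<Sum>j\<le>k. of_nat (Suc k choose Suc j) * (F (Suc j) * G (k - j)))"
    by (subst sum.atMost_Suc_shift) simp
  also have "\<dots> = (F 0 * G (Suc k) + (\<Sum>j\<le>k. of_nat (k choose Suc j) * (F (Suc j) * G (k - j))))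
      + (\<Sum>j\<le>k. of_nat (k choose j) * (F (Suc j) * G (k - j)))"
    by (simp add: algebra_simps sum.distrib)
  also have "F 0 * G (Suc k) + (\<Sum>j\<le>k. of_nat (k choose Suc j) * (F (Suc j) * G (k - j))) =
      (\<Sum>j\<le>Suc k. of_nat (k choose j) * (F j * G (Suc k - j)))"
    by (subst sum.atMost_Suc_shift) simp
  also have "\<dots> = (\<Sum>j\<le>k. of_nat (k choose j) * (F j * G (Suc (k - j))))"
    by (simp add: Suc_diff_le binomial_eq_0)
  finally show ?thesis
    by (simp add: sum.distrib algebra_simps)
qed

lemma smooth_curve_on_mult:
  assumes "open U" "smooth_curve_on U f" "smooth_curve_on U g"
  shows "smooth_curve_on U (\<lambda>t. f t * g t)"
    and "\<And>k t. t \<in> U \<Longrightarrow>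
      ndv k (\<lambda>t. f t * g t) t = (\<Sum>j\<le>k. of_nat (k choose j) * (ndv j f t * ndv (k - j) g t))"
proof -
  let ?D = "\<lambda>k t. \<Sum>j\<le>k. of_nat (k choose j) * (ndv j f t * ndv (k - j) g t)"
  note j = ndv_jet[of U ?D "\<lambda>t. f t * g t", OF assms(1)]
  have d: "(?D k has_vector_derivative ?D (Suc k) t) (at t)" if t: "t \<in> U" for k t
  proof -
    have "(?D k has_vector_derivative (\<Sum>j\<le>k. of_nat (k choose j) *
        (ndv j f t * ndv (Suc (k - j)) g t + ndv (Suc j) f t * ndv (k - j) g t))) (at t)"
      by (intro has_vector_derivative_sum has_vector_derivative_mult_right
          has_vector_derivative_mult smooth_curve_onD[OF _ t] assms)
    then show ?thesis by (subst (asm) Leibniz_sum_Suc)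
  qed
  show "smooth_curve_on U (\<lambda>t. f t * g t)" by (rule j) (auto intro: d simp del: sum.atMost_Suc)
  show "\<And>k t. t \<in> U \<Longrightarrow> ndv k (\<lambda>t. f t * g t) t = ?D k t"
    by (rule j) (auto intro: d simp del: sum.atMost_Suc)
qed

section \<open>Denjoy--Carleman classes with uniform bounds\<close>

text \<open>The index triangle \<open>i + j \<le> k\<close> lies in the square, and all terms are
  non-negative.\<close>

lemma sum_Cauchy_product_le:
  fixes a b :: "nat \<Rightarrow> real"
  assumes "\<And>j. 0 \<le> a j" "\<And>j. 0 \<le> b j"
  shows "(\<Sum>i\<le>k. \<Sum>j\<le>i. a j * b (i - j)) \<le> (\<Sum>j\<le>k. a j) * (\<Sum>j\<le>k. b j)"
proof -
  have "(\<Sum>i\<le>k. \<Sum>j\<le>i. a j * b (i - j)) = (\<Sum>(i, j)\<in>{(i, j). i + j \<le> k}. a i * b j)"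
    by (simp add: sum.triangle_reindex_eq)
  also have "\<dots> \<le> (\<Sum>(i, j)\<in>{..k} \<times> {..k}. a i * b j)"
    by (intro sum_mono2) (auto simp: assms)
  finally show ?thesis
    by (simp add: sum_product sum.cartesian_product)
qed

locale dc_weight =
  fixes M :: "nat \<Rightarrow> real"
  assumes dc: "DC_weight_sequence M"
begin

lemma M_pos [simp]: "0 < M k" and M_0 [simp]: "M 0 = 1" and M_mono: "mono M"
  and M_log_convex: "k \<ge> 1 \<Longrightarrow> (M k)\<^sup>2 \<le> M (k - 1) * M (k + 1)"
  using dc by (auto simp: DC_weight_sequence_def)

lemma M_nonneg [simp]: "0 \<le> M k" and M_neq_0 [simp]: "M k \<noteq> 0"
  using M_pos[of k] by linarith+

lemma M_ratio_mono: "M (Suc j) / M j \<le> M (Suc (j + i)) / M (j + i)"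
proof (induction i)
  case (Suc i)
  have "M (Suc (j + i)) / M (j + i) \<le> M (Suc (j + Suc i)) / M (j + Suc i)"
    using M_log_convex[of "Suc (j + i)"] by (simp add: field_simps power2_eq_square)
  with Suc show ?case by linarith
qed simp

text \<open>The induction starts from \<open>M 0 = 1\<close>. Raising \<open>i\<close> by one
  multiplies the left side by a ratio of consecutive weights and the right side by such a ratio at a
  larger index, which is at least as large by log-convexity.\<close>

lemma M_mult_le: "M i * M j \<le> M (i + j)"
proof (induction i)
  case (Suc i)
  have "M (Suc i) * M j = (M (Suc i) / M i) * (M i * M j)"
    by simp
  also have "\<dots> \<le> (M (Suc (i + j)) / M (i + j)) * M (i + j)"
    using M_ratio_mono[of i j] Suc by (intro mult_mono) auto
  finally show ?case by simp
qed simp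

definition CM_curve_on :: "real set \<Rightarrow> (real \<Rightarrow> complex) \<Rightarrow> bool" where
  "CM_curve_on U f \<longleftrightarrow> smooth_curve_on U f \<and>
     (\<exists>C>0. \<exists>\<rho>>0. \<forall>k. \<forall>t\<in>U. norm (ndv k f t) \<le> C * \<rho> ^ k * fact k * M k)"

lemma CM_curve_on_subset: "CM_curve_on U f \<Longrightarrow> V \<subseteq> U \<Longrightarrow> CM_curve_on V f"
  unfolding CM_curve_on_def using smooth_curve_on_subset[of U f V] by blast

lemma CM_curve_on_smooth: "CM_curve_on U f \<Longrightarrow> smooth_curve_on U f"
  by (simp add: CM_curve_on_def)

lemma CM_curve_on_cong:
  assumes "open U" "\<And>t. t \<in> U \<Longrightarrow> f t = g t" "CM_curve_on U f"
  shows "CM_curve_on U g"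
  using assms(3) smooth_curve_on_cong[OF assms(1,2)] by (auto simp: CM_curve_on_def)

text \<open>The weighted truncated Taylor norm at a point; log-convexity of \<open>M\<close> makes it
  submultiplicative.\<close>

definition jet_norm :: "real \<Rightarrow> nat \<Rightarrow> (real \<Rightarrow> complex) \<Rightarrow> real \<Rightarrow> real" where
  "jet_norm R k f t = (\<Sum>j\<le>k. norm (ndv j f t) / (R ^ j * fact j * M j))"

lemma jet_norm_nonneg: "R > 0 \<Longrightarrow> 0 \<le> jet_norm R k f t"
  unfolding jet_norm_def by (intro sum_nonneg) simp

lemma jet_norm_add:
  assumes "R > 0" "open U" "smooth_curve_on U f" "smooth_curve_on U g" "t \<in> U"
  shows "jet_norm R k (\<lambda>t. f t + g t) t \<le> jet_norm R k f t + jet_norm R k g t"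
  unfolding jet_norm_def sum.distrib[symmetric] smooth_curve_on_add(2)[OF assms(2-5)]
  using \<open>R > 0\<close>
  by (intro sum_mono) (simp add: divide_right_mono norm_triangle_ineq flip: add_divide_distrib)

lemma jet_norm_mult:
  assumes "R > 0" "open U" "smooth_curve_on U f" "smooth_curve_on U g" "t \<in> U"
  shows "jet_norm R k (\<lambda>t. f t * g t) t \<le> jet_norm R k f t * jet_norm R k g t"
proof -
  let ?w = "\<lambda>f j. norm (ndv j f t) / (R ^ j * fact j * M j)"
  have "?w (\<lambda>t. f t * g t) i \<le> (\<Sum>j\<le>i. ?w f j * ?w g (i - j))" for i
  proof -
    have "?w (\<lambda>t. f t * g t) i \<le>
        (\<Sum>j\<le>i. norm (of_nat (i choose j) * (ndv j f t * ndv (i - j) g t))) / (R ^ i * fact i * M i)"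
      unfolding smooth_curve_on_mult(2)[OF assms(2-5)]
      using \<open>R > 0\<close> by (intro divide_right_mono norm_sum) auto
    also have "\<dots> = (\<Sum>j\<le>i. real (i choose j) * (norm (ndv j f t) * norm (ndv (i - j) g t)) /
        (R ^ i * fact i * M i))"
      by (simp add: sum_divide_distrib norm_mult)
    also have "\<dots> \<le> (\<Sum>j\<le>i. ?w f j * ?w g (i - j))"
    proof (rule sum_mono)
      fix j assume "j \<in> {..i}"
      then have j: "j \<le> i" by simp
      have c: "real (i choose j) / fact i = 1 / (fact j * fact (i - j))"
        using j by (simp add: binomial_fact)
      have r: "R ^ i = R ^ j * R ^ (i - j)"
        using j by (simp flip: power_add)
      have "real (i choose j) * (norm (ndv j f t) * norm (ndv (i - j) g t)) / (R ^ i * fact i * M i)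
          = (norm (ndv j f t) * norm (ndv (i - j) g t) / (R ^ i * (fact j * fact (i - j)))) / M i"
        using c j by (simp add: field_simps)
      \<comment> \<open>The binomial coefficient has been absorbed by the factorials; what remains
        is to split the weight by \<open>M j * M (i - j) \<le> M i\<close>.\<close>
      also have "\<dots> \<le> (norm (ndv j f t) * norm (ndv (i - j) g t) / (R ^ i * (fact j * fact (i - j))))
          / (M j * M (i - j))"
        using M_mult_le[of j "i - j"] j \<open>R > 0\<close> by (intro divide_left_mono) auto
      also have "\<dots> = ?w f j * ?w g (i - j)"
        by (simp add: r mult_ac)
      finally show "real (i choose j) * (norm (ndv j f t) * norm (ndv (i - j) g t)) /
          (R ^ i * fact i * M i) \<le> ?w f j * ?w g (i - j)" .
    qed
    finally show ?thesis .
  qed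
  then have "jet_norm R k (\<lambda>t. f t * g t) t \<le> (\<Sum>i\<le>k. \<Sum>j\<le>i. ?w f j * ?w g (i - j))"
    unfolding jet_norm_def by (intro sum_mono) simp
  also have "\<dots> \<le> jet_norm R k f t * jet_norm R k g t"
    unfolding jet_norm_def using \<open>R > 0\<close> by (intro sum_Cauchy_product_le) auto
  finally show ?thesis .
qed

text \<open>Once \<open>R\<close> is at least \<open>2 * \<rho>\<close>, the terms are dominated by
  a geometric series of ratio \<open>1/2\<close>. The constant is chosen before \<open>R\<close>;
  later arguments enlarge \<open>R\<close> while keeping it.\<close>

lemma CM_curve_on_jet_norm:
  assumes "CM_curve_on U f"
  shows "\<exists>C. \<forall>\<^sub>F R in at_top. \<forall>k. \<forall>t\<in>U. jet_norm R k f t \<le> C"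
proof -
  obtain C \<rho> where C: "C > 0" "\<rho> > 0" "\<And>k t. t \<in> U \<Longrightarrow> norm (ndv k f t) \<le> C * \<rho> ^ k * fact k * M k"
    using assms by (auto simp: CM_curve_on_def)
  have "jet_norm R k f t \<le> 2 * C" if R: "R \<ge> 2 * \<rho>" and t: "t \<in> U" for R k t
  proof -
    have "R > 0" using R C by linarith
    have "norm (ndv j f t) / (R ^ j * fact j * M j) \<le> C * (1/2) ^ j" for j
    proof -
      have "norm (ndv j f t) / (R ^ j * fact j * M j) \<le> C * \<rho> ^ j * fact j * M j / (R ^ j * fact j * M j)"
        using \<open>R > 0\<close> C(3)[OF t, of j] by (intro divide_right_mono) auto
      also have "\<dots> = C * (\<rho> / R) ^ j"
        by (simp add: power_divide)
      also have "\<dots> \<le> C * (1/2) ^ j"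
        using R C \<open>R > 0\<close> by (intro mult_left_mono power_mono) (auto simp: field_simps)
      finally show ?thesis .
    qed
    then have "jet_norm R k f t \<le> (\<Sum>j\<le>k. C * (1/2) ^ j)"
      unfolding jet_norm_def by (intro sum_mono)
    also have "\<dots> = C * (2 - (1/2) ^ k)"
      by (induction k) (simp_all add: algebra_simps)
    also have "\<dots> \<le> C * 2" using C by (intro mult_left_mono) auto
    finally show ?thesis by simp
  qed
  then show ?thesis
    by (intro exI[of _ "2 * C"] eventually_at_top_linorderI[of "2 * \<rho>"]) auto
qed

lemma CM_curve_onI_jet_norm:
  assumes "smooth_curve_on U f" "R > 0" "\<And>k t. t \<in> U \<Longrightarrow> jet_norm R k f t \<le> C"
  shows "CM_curve_on U f"
proof -
  \<comment> \<open>The class asks for a positive constant, which \<open>C\<close> itself need not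
    be; hence \<open>max C 1\<close>.\<close>
  have "norm (ndv k f t) \<le> max C 1 * R ^ k * fact k * M k" if "t \<in> U" for k t
  proof -
    have "norm (ndv k f t) / (R ^ k * fact k * M k) \<le> jet_norm R k f t"
      unfolding jet_norm_def using \<open>R > 0\<close> by (intro member_le_sum) auto
    also have "\<dots> \<le> max C 1" using assms(3)[OF that, of k] by simp
    finally show ?thesis using \<open>R > 0\<close> by (simp add: field_simps)
  qed
  then show ?thesis
    unfolding CM_curve_on_def using assms
    by (intro conjI exI[of _ "max C 1"] exI[of _ R]) auto
qed

lemma CM_curve_on_const: "open U \<Longrightarrow> CM_curve_on U (\<lambda>t. c :: complex)"
  unfolding CM_curve_on_def
  using smooth_curve_on_const(1)[of U c] smooth_curve_on_const(2)[of U _ _ c]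
  by (intro conjI exI[of _ "norm (c::complex) + 1"] exI[of _ 1])
    (auto simp: add_nonneg_pos mult_nonneg_nonneg)

lemma M_DC_bound: "\<exists>B\<ge>1. \<forall>k. M (Suc k) \<le> B * B ^ k * M k"
proof -
  obtain B where B: "\<forall>k\<ge>1. (M (k + 1) / M k) powr (1 / real k) \<le> B"
    using dc by (auto simp: DC_weight_sequence_def)
  \<comment> \<open>\<open>M 1\<close> covers the index \<open>k = 0\<close>, on which the growth
    condition is silent.\<close>
  define B' where "B' = max (max 1 B) (M 1)"
  have "M (Suc k) \<le> B' * B' ^ k * M k" for k
  proof (cases "k = 0")
    case False
    have "M (Suc k) / M k = ((M (k + 1) / M k) powr (1 / real k)) ^ k"
      using False by (simp add: powr_power)
    also have "\<dots> \<le> B' ^ k" using B[rule_format, of k] False by (intro power_mono) (auto simp: B'_def)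
    also have "\<dots> \<le> B' * B' ^ k"
      using mult_right_mono[of 1 B' "B' ^ k"] by (simp add: B'_def)
    finally show ?thesis by (simp add: field_simps)
  qed (simp add: B'_def)
  then show ?thesis by (intro exI[of _ B']) (auto simp: B'_def)
qed

text \<open>Shifting the index costs \<open>\<rho> * Suc k * M (Suc k) / M k\<close>, which grows at
  most geometrically in \<open>k\<close>. Both derivation and Hadamard's quotient consume one
  derivative and are paid for here.\<close>

lemma CM_bound_shift:
  assumes "C > 0" "\<rho> > 0"
  shows "\<exists>C'>0. \<exists>\<rho>'>0. \<forall>k. C * \<rho> ^ Suc k * fact (Suc k) * M (Suc k) \<le> C' * \<rho>' ^ k * fact k * M k"
proof -
  obtain B where B: "B \<ge> 1" "\<And>k. M (Suc k) \<le> B * B ^ k * M k" using M_DC_bound by blast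
  have le: "C * \<rho> ^ Suc k * fact (Suc k) * M (Suc k) \<le> (C * \<rho> * B) * (2 * \<rho> * B) ^ k * fact k * M k" for k
  proof -
    have "real (Suc k) \<le> 2 ^ k"
      by (metis Suc_leI less_exp of_nat_le_iff of_nat_numeral of_nat_power)
    then have "(C * \<rho> ^ Suc k * fact k) * (real (Suc k) * M (Suc k)) \<le>
        (C * \<rho> ^ Suc k * fact k) * (2 ^ k * (B * B ^ k * M k))"
      using assms B by (intro mult_left_mono mult_mono) auto
    then show ?thesis by (simp add: power_mult_distrib mult_ac)
  qed
  then show ?thesis using assms B(1)
    by (intro exI[of _ "C * \<rho> * B"] exI[of _ "2 * \<rho> * B"] conjI allI) auto
qed

lemma CM_curve_on_ndv:
  assumes "CM_curve_on U f"
  shows "CM_curve_on U (ndv (Suc 0) f)"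
proof -
  obtain C \<rho> where C: "C > 0" "\<rho> > 0" "\<And>k t. t \<in> U \<Longrightarrow> norm (ndv k f t) \<le> C * \<rho> ^ k * fact k * M k"
    using assms by (auto simp: CM_curve_on_def)
  obtain C' \<rho>' where C': "C' > 0" "\<rho>' > 0"
    "\<And>k. C * \<rho> ^ Suc k * fact (Suc k) * M (Suc k) \<le> C' * \<rho>' ^ k * fact k * M k"
    using CM_bound_shift[OF C(1,2)] by blast
  have "norm (ndv k (ndv (Suc 0) f) t) \<le> C' * \<rho>' ^ k * fact k * M k" if "t \<in> U" for k t
    using C(3)[OF that, of "Suc k"] C'(3)[of k] by (simp only: flip: ndv_Suc')
  then show ?thesis
    using assms smooth_curve_on_ndv C' unfolding CM_curve_on_def by blast
qed

end

section \<open>Polynomial differential equations with coefficients in the class\<close>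

text \<open>Polynomial expressions in the members of \<open>S\<close>, as an inductive closure
  instead of polynomials in many variables. There is no rule for constants or negation: constants
  enter as members of \<open>S\<close>, and \<open>- 1\<close> is a constant factor.\<close>

inductive_set gen_alg :: "(real \<Rightarrow> complex) set \<Rightarrow> (real \<Rightarrow> complex) set" for S where
  base: "f \<in> S \<Longrightarrow> f \<in> gen_alg S"
| add: "f \<in> gen_alg S \<Longrightarrow> g \<in> gen_alg S \<Longrightarrow> (\<lambda>t. f t + g t) \<in> gen_alg S"
| mult: "f \<in> gen_alg S \<Longrightarrow> g \<in> gen_alg S \<Longrightarrow> (\<lambda>t. f t * g t) \<in> gen_alg S"

text \<open>The product rule keeps derivatives inside the algebra. Two generating sets are allowed,
  since differentiating the generators in \<open>S\<close> may bring in new ones from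
  \<open>T\<close>.\<close>

lemma gen_alg_has_derivative:
  assumes ST: "S \<subseteq> T"
    and S: "\<And>f. f \<in> S \<Longrightarrow> \<exists>g\<in>gen_alg T. \<forall>t\<in>U. (f has_vector_derivative g t) (at t)"
    and f: "f \<in> gen_alg S"
  shows "f \<in> gen_alg T" and "\<exists>g\<in>gen_alg T. \<forall>t\<in>U. (f has_vector_derivative g t) (at t)"
proof -
  have "f \<in> gen_alg T \<and> (\<exists>g\<in>gen_alg T. \<forall>t\<in>U. (f has_vector_derivative g t) (at t))"
    using f
  proof induction
    case (base f)
    then show ?case using ST S by (auto intro: gen_alg.base)
  next
    case (add f g)
    then obtain f' g' where "f' \<in> gen_alg T" "g' \<in> gen_alg T"
      "\<forall>t\<in>U. (f has_vector_derivative f' t) (at t)" "\<forall>t\<in>U. (g has_vector_derivative g' t) (at t)"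
      by blast
    then show ?case using add
      by (intro conjI bexI[of _ "\<lambda>t. f' t + g' t"] gen_alg.add) (auto intro: has_vector_derivative_add)
  next
    case (mult f g)
    then obtain f' g' where "f' \<in> gen_alg T" "g' \<in> gen_alg T"
      "\<forall>t\<in>U. (f has_vector_derivative f' t) (at t)" "\<forall>t\<in>U. (g has_vector_derivative g' t) (at t)"
      by blast
    then show ?case using mult
      by (intro conjI bexI[of _ "\<lambda>t. f t * g' t + f' t * g t"] gen_alg.add gen_alg.mult)
        (auto intro: has_vector_derivative_mult)
  qed
  then show "f \<in> gen_alg T" "\<exists>g\<in>gen_alg T. \<forall>t\<in>U. (f has_vector_derivative g t) (at t)"
    by auto
qed

lemma gen_alg_smooth:
  assumes U: "open U"
    and S: "\<And>f. f \<in> S \<Longrightarrow> \<exists>g\<in>gen_alg S. \<forall>t\<in>U. (f has_vector_derivative g t) (at t)"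
    and f: "f \<in> gen_alg S"
  shows "smooth_curve_on U f"
proof -
  have "\<exists>g\<in>gen_alg S. \<forall>t\<in>U. (f has_vector_derivative g t) (at t)" if "f \<in> gen_alg S" for f
    using gen_alg_has_derivative(2)[of S S U f] S that by blast
  then obtain d where d: "\<And>f. f \<in> gen_alg S \<Longrightarrow> d f \<in> gen_alg S"
    "\<And>f t. f \<in> gen_alg S \<Longrightarrow> t \<in> U \<Longrightarrow> (f has_vector_derivative d f t) (at t)"
    by metis
  have "(d ^^ k) f \<in> gen_alg S" for k
    by (induction k) (auto intro: d f)
  then show ?thesis
    by (intro ndv_jet(1)[of U "\<lambda>k. (d ^^ k) f"] U) (auto intro: d)
qed

lemma gen_alg_power: "(\<lambda>t. 1) \<in> S \<Longrightarrow> f \<in> gen_alg S \<Longrightarrow> (\<lambda>t. f t ^ n) \<in> gen_alg S"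
  by (induction n) (auto intro: gen_alg.intros)

lemma gen_alg_sum:
  "(\<lambda>t. 0) \<in> S \<Longrightarrow> (\<And>i. i \<in> I \<Longrightarrow> f i \<in> gen_alg S) \<Longrightarrow> (\<lambda>t. \<Sum>i\<in>I. f i t) \<in> gen_alg S"
  by (induction I rule: infinite_finite_induct) (auto intro: gen_alg.intros)

context dc_weight
begin

text \<open>Passing from \<open>f\<close> to its derivative shifts the order by one. The factorial
  and \<open>M\<close> only grow under the shift, while one factor \<open>R\<close> is left over;
  this gain \<open>1 / R\<close> is what absorbs constants later.\<close>

lemma jet_norm_Suc_le:
  assumes R: "R > 0" and U: "open U" and f: "smooth_curve_on U f" and t: "t \<in> U"
    and g: "\<And>t. t \<in> U \<Longrightarrow> (f has_vector_derivative g t) (at t)"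
  shows "jet_norm R (Suc k) f t \<le> norm (f t) + jet_norm R k g t / R"
proof -
  have "norm (ndv (Suc j) f t) / (R ^ Suc j * fact (Suc j) * M (Suc j)) \<le>
      norm (ndv j g t) / (R ^ j * fact j * M j) / R" for j
  proof -
    have "R ^ j * fact j * M j * R \<le> R ^ Suc j * fact (Suc j) * M (Suc j)"
    proof -
      have "(R ^ Suc j * fact j) * (1 * M j) \<le> (R ^ Suc j * fact j) * (real (Suc j) * M (Suc j))"
        using R monoD[OF M_mono, of j "Suc j"] by (intro mult_left_mono mult_mono) auto
      then show ?thesis by (simp add: mult_ac)
    qed
    moreover have eq: "ndv (Suc j) f t = ndv j g t"
      using ndv_derivative(2)[OF U f _ t] g by blast
    ultimately show ?thesis
      unfolding eq divide_divide_eq_left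
      using R by (intro divide_left_mono) auto
  qed
  then have "(\<Sum>j\<le>k. norm (ndv (Suc j) f t) / (R ^ Suc j * fact (Suc j) * M (Suc j))) \<le>
      jet_norm R k g t / R"
    unfolding jet_norm_def sum_divide_distrib by (intro sum_mono)
  then show ?thesis
    unfolding jet_norm_def[of R "Suc k"] by (subst sum.atMost_Suc_shift) simp
qed

text \<open>\<open>P\<close> is a slot for an induction hypothesis, so that the estimate may be used
  conditionally at one order \<open>k\<close> and one point \<open>t\<close>. As the norm respects
  sums and products, \<open>C\<close> stays independent of \<open>R\<close>.\<close>

lemma gen_alg_jet_norm:
  assumes U: "open U" and sm: "\<And>h. h \<in> gen_alg S \<Longrightarrow> smooth_curve_on U h"
    and S: "\<And>h. h \<in> S \<Longrightarrow> \<exists>C. \<forall>\<^sub>F R in at_top. \<forall>k. \<forall>t\<in>U. P R k t \<longrightarrow> jet_norm R k h t \<le> C"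
    and h: "h \<in> gen_alg S"
  shows "\<exists>C. \<forall>\<^sub>F R in at_top. \<forall>k. \<forall>t\<in>U. P R k t \<longrightarrow> jet_norm R k h t \<le> C"
  using h
proof induction
  case (add f g)
  then obtain A B where
    "\<forall>\<^sub>F R in at_top. \<forall>k. \<forall>t\<in>U. P R k t \<longrightarrow> jet_norm R k f t \<le> A"
    "\<forall>\<^sub>F R in at_top. \<forall>k. \<forall>t\<in>U. P R k t \<longrightarrow> jet_norm R k g t \<le> B"
    by blast
  then have "\<forall>\<^sub>F R in at_top. \<forall>k. \<forall>t\<in>U. P R k t \<longrightarrow> jet_norm R k (\<lambda>t. f t + g t) t \<le> A + B"
    using eventually_gt_at_top[of 0]
  proof eventually_elim
    case (elim R)
    show ?case
    proof (intro allI ballI impI)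
      fix k t assume t: "t \<in> U" "P R k t"
      have "jet_norm R k (\<lambda>t. f t + g t) t \<le> jet_norm R k f t + jet_norm R k g t"
        using elim t by (intro jet_norm_add[OF _ U] sm add)
      also have "\<dots> \<le> A + B" using elim t by (intro add_mono) auto
      finally show "jet_norm R k (\<lambda>t. f t + g t) t \<le> A + B" .
    qed
  qed
  then show ?case by blast
next
  case (mult f g)
  then obtain A B where
    "\<forall>\<^sub>F R in at_top. \<forall>k. \<forall>t\<in>U. P R k t \<longrightarrow> jet_norm R k f t \<le> A"
    "\<forall>\<^sub>F R in at_top. \<forall>k. \<forall>t\<in>U. P R k t \<longrightarrow> jet_norm R k g t \<le> B"
    by blast
  then have "\<forall>\<^sub>F R in at_top. \<forall>k. \<forall>t\<in>U. P R k t \<longrightarrow> jet_norm R k (\<lambda>t. f t * g t) t \<le> A * B"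
    using eventually_gt_at_top[of 0]
  proof eventually_elim
    case (elim R)
    show ?case
    proof (intro allI ballI impI)
      fix k t assume t: "t \<in> U" "P R k t"
      have f: "0 \<le> jet_norm R k f t" "jet_norm R k f t \<le> A"
        and g: "0 \<le> jet_norm R k g t" "jet_norm R k g t \<le> B"
        using elim t by (auto intro: jet_norm_nonneg)
      have "jet_norm R k (\<lambda>t. f t * g t) t \<le> jet_norm R k f t * jet_norm R k g t"
        using elim t by (intro jet_norm_mult[OF _ U] sm mult)
      also have "\<dots> \<le> A * B" using f g by (intro mult_mono) auto
      finally show "jet_norm R k (\<lambda>t. f t * g t) t \<le> A * B" .
    qed
  qed
  then show ?case by blast
qed (rule S)

lemma CM_curve_on_derivative:
  assumes f: "CM_curve_on U f"
  shows "\<exists>g\<in>gen_alg (S \<union> Collect (CM_curve_on U)). \<forall>t\<in>U. (f has_vector_derivative g t) (at t)"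
  using smooth_curve_onD[OF CM_curve_on_smooth[OF f], of _ 0] CM_curve_on_ndv[OF f]
  by (intro bexI[of _ "ndv (Suc 0) f"]) (auto intro: gen_alg.base)

lemma gen_alg_CM_smooth:
  "open U \<Longrightarrow> h \<in> gen_alg (Collect (CM_curve_on U)) \<Longrightarrow> smooth_curve_on U h"
  using CM_curve_on_derivative[of U _ "{}"] gen_alg_smooth[of U "Collect (CM_curve_on U)" h] by simp

lemma CM_curve_on_gen_alg:
  assumes "open U" "h \<in> gen_alg (Collect (CM_curve_on U))"
  shows "CM_curve_on U h"
proof -
  have "\<exists>C. \<forall>\<^sub>F R in at_top. \<forall>k. \<forall>t\<in>U. True \<longrightarrow> jet_norm R k h t \<le> C"
    by (rule gen_alg_jet_norm[OF assms(1) _ _ assms(2)])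
      (use CM_curve_on_jet_norm gen_alg_CM_smooth[OF assms(1)] in auto)
  then obtain C where "\<forall>\<^sub>F R in at_top. \<forall>k. \<forall>t\<in>U. jet_norm R k h t \<le> C" by auto
  then have "\<forall>\<^sub>F R in at_top. R > 0 \<and> (\<forall>k. \<forall>t\<in>U. jet_norm R k h t \<le> C)"
    by (intro eventually_conj eventually_gt_at_top)
  then obtain R where "R > 0" "\<And>k t. t \<in> U \<Longrightarrow> jet_norm R k h t \<le> C"
    using eventually_happens'[OF trivial_limit_at_top_linorder] by blast
  then show ?thesis
    by (intro CM_curve_onI_jet_norm gen_alg_CM_smooth assms)
qed

text \<open>By \<open>jet_norm_Suc_le\<close>, which rests on \<open>M\<close> being non-decreasing, the equation propagates a bound on
  the norms from order \<open>k\<close> to order \<open>k + 1\<close> once \<open>R\<close> is large.\<close>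

lemma polynomial_ode_CM:
  fixes F :: "(real \<Rightarrow> complex) set"
  assumes U: "open U" and F: "finite F"
    and bdd: "\<And>f. f \<in> F \<Longrightarrow> \<exists>C. \<forall>t\<in>U. norm (f t) \<le> C"
    and ode: "\<And>f. f \<in> F \<Longrightarrow> \<exists>g\<in>gen_alg (F \<union> Collect (CM_curve_on U)).
                \<forall>t\<in>U. (f has_vector_derivative g t) (at t)"
    and f: "f \<in> F"
  shows "CM_curve_on U f"
proof -
  let ?S = "F \<union> Collect (CM_curve_on U)"
  have "\<exists>g\<in>gen_alg ?S. \<forall>t\<in>U. (h has_vector_derivative g t) (at t)" if "h \<in> ?S" for h
  proof (cases "h \<in> F")
    case False
    with that show ?thesis by (intro CM_curve_on_derivative) simp
  qed (rule ode)
  then have sm: "smooth_curve_on U h" if "h \<in> gen_alg ?S" for h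
    by (intro gen_alg_smooth[OF U _ that])
  obtain c where c: "\<And>f t. f \<in> F \<Longrightarrow> t \<in> U \<Longrightarrow> norm (f t) \<le> c f"
    using bdd by metis
  \<comment> \<open>The summand \<open>1\<close> leaves room above every \<open>norm (f t)\<close>
    for the derivative term, which will be at most \<open>1\<close>.\<close>
  define C where "C = 1 + (\<Sum>f\<in>F. \<bar>c f\<bar>)"
  have C: "norm (f t) + 1 \<le> C" if "f \<in> F" "t \<in> U" for f t
    using c[OF that] member_le_sum[of f F "\<lambda>f. \<bar>c f\<bar>"] that F abs_ge_self[of "c f"]
    unfolding C_def by simp
  have est: "\<exists>C'. \<forall>\<^sub>F R in at_top. \<forall>k. \<forall>t\<in>U. (\<forall>f\<in>F. jet_norm R k f t \<le> C) \<longrightarrow> jet_norm R k h t \<le> C'"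
    if "h \<in> gen_alg ?S" for h
  proof (rule gen_alg_jet_norm[OF U sm _ that])
    fix h assume "h \<in> ?S"
    then consider "h \<in> F" | "CM_curve_on U h" by auto
    then show "\<exists>C'. \<forall>\<^sub>F R in at_top. \<forall>k. \<forall>t\<in>U. (\<forall>f\<in>F. jet_norm R k f t \<le> C) \<longrightarrow> jet_norm R k h t \<le> C'"
    proof cases
      case 1
      then show ?thesis by (intro exI[of _ C] always_eventually) blast
    next
      case 2
      then obtain C' where "\<forall>\<^sub>F R in at_top. \<forall>k. \<forall>t\<in>U. jet_norm R k h t \<le> C'"
        using CM_curve_on_jet_norm by blast
      then show ?thesis by (intro exI[of _ C']) (auto elim: eventually_mono)
    qed
  qed
  obtain d where d: "\<And>f. f \<in> F \<Longrightarrow> d f \<in> gen_alg ?S"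
    "\<And>f t. f \<in> F \<Longrightarrow> t \<in> U \<Longrightarrow> (f has_vector_derivative d f t) (at t)"
    using ode by metis
  \<comment> \<open>The conditional bounds on the right-hand sides do not depend on
    \<open>R\<close>, so \<open>R\<close> eventually exceeds them all.\<close>
  have "\<forall>f\<in>F. \<forall>\<^sub>F R in at_top. \<forall>k. \<forall>t\<in>U. (\<forall>f\<in>F. jet_norm R k f t \<le> C) \<longrightarrow> jet_norm R k (d f) t \<le> R"
  proof
    fix f assume "f \<in> F"
    then obtain C' where "\<forall>\<^sub>F R in at_top. \<forall>k. \<forall>t\<in>U. (\<forall>f\<in>F. jet_norm R k f t \<le> C) \<longrightarrow>
        jet_norm R k (d f) t \<le> C'"
      using est d(1) by blast
    then show "\<forall>\<^sub>F R in at_top. \<forall>k. \<forall>t\<in>U. (\<forall>f\<in>F. jet_norm R k f t \<le> C) \<longrightarrow> jet_norm R k (d f) t \<le> R"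
      using eventually_ge_at_top[of C'] by eventually_elim (blast intro: order_trans)
  qed
  then have "\<forall>\<^sub>F R in at_top. R > 0 \<and>
      (\<forall>f\<in>F. \<forall>k. \<forall>t\<in>U. (\<forall>f\<in>F. jet_norm R k f t \<le> C) \<longrightarrow> jet_norm R k (d f) t \<le> R)"
    using eventually_gt_at_top[of "0::real"] F by (intro eventually_conj eventually_ball_finite)
  then obtain R where R: "R > 0"
    "\<And>f k t. f \<in> F \<Longrightarrow> t \<in> U \<Longrightarrow> \<forall>f\<in>F. jet_norm R k f t \<le> C \<Longrightarrow> jet_norm R k (d f) t \<le> R"
    using eventually_happens'[OF trivial_limit_at_top_linorder] by blast
  have "\<forall>f\<in>F. \<forall>t\<in>U. jet_norm R k f t \<le> C" for k
  proof (induction k)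
    case 0
    then show ?case using C by (force simp: jet_norm_def)
  next
    case (Suc k)
    show ?case
    proof (intro ballI)
      fix f t assume ft: "f \<in> F" "t \<in> U"
      then have "f \<in> gen_alg ?S" by (auto intro: gen_alg.base)
      then have "jet_norm R (Suc k) f t \<le> norm (f t) + jet_norm R k (d f) t / R"
        using R(1) U ft d by (intro jet_norm_Suc_le[of R U] sm) auto
      also have "\<dots> \<le> norm (f t) + 1" using R Suc ft by (auto simp: divide_le_eq_1)
      also have "\<dots> \<le> C" using C ft by simp
      finally show "jet_norm R (Suc k) f t \<le> C" .
    qed
  qed
  then show ?thesis
    using f R(1) by (intro CM_curve_onI_jet_norm[of U f R C] sm) (auto intro: gen_alg.base)
qed

end

section \<open>Germs at the origin\<close>

text \<open>Requiring all sufficiently small radii lets finitely many germs share one ball by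
  conjunction of eventual properties.\<close>

definition smooth_germ :: "(real \<Rightarrow> complex) \<Rightarrow> bool" where
  "smooth_germ f \<longleftrightarrow> (\<forall>\<^sub>F \<delta> in at_right 0. smooth_curve_on (ball 0 \<delta>) f)"

definition flat_at_0 :: "(real \<Rightarrow> complex) \<Rightarrow> bool" where
  "flat_at_0 f \<longleftrightarrow> (\<forall>k. ndv k f 0 = 0)"

definition (in dc_weight) CM_germ :: "(real \<Rightarrow> complex) \<Rightarrow> bool" where
  "CM_germ f \<longleftrightarrow> (\<forall>\<^sub>F \<delta> in at_right 0. CM_curve_on (ball 0 \<delta>) f)"

lemma eventually_at_right_0_obtain:
  assumes "\<forall>\<^sub>F \<delta> in at_right (0::real). P \<delta>"
  obtains \<delta> where "\<delta> > 0" "P \<delta>"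
proof -
  have "\<forall>\<^sub>F \<delta> in at_right (0::real). \<delta> > 0 \<and> P \<delta>"
    using assms by (intro eventually_conj eventually_at_right_less)
  then show ?thesis
    using that eventually_happens'[OF trivial_limit_at_right_real] by blast
qed

lemma eventually_at_right_0I:
  assumes "\<delta> > 0" "\<And>d. 0 < d \<Longrightarrow> d \<le> \<delta> \<Longrightarrow> P d"
  shows "\<forall>\<^sub>F \<delta> in at_right (0::real). P \<delta>"
  using assms by (auto simp: eventually_at_right_field intro!: exI[of _ \<delta>])

lemma eventually_ball_at_right_0:
  assumes "\<forall>\<^sub>F t in nhds (0::real). P t"
  shows "\<forall>\<^sub>F \<delta> in at_right 0. \<forall>t\<in>ball 0 \<delta>. P t"
proof -
  obtain d where "d > 0" "\<And>t. dist t 0 < d \<Longrightarrow> P t"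
    using assms by (auto simp: eventually_nhds_metric)
  then show ?thesis
    by (intro eventually_at_right_0I[of d]) (auto simp: dist_commute)
qed

lemma smooth_germI: "\<delta> > 0 \<Longrightarrow> smooth_curve_on (ball 0 \<delta>) f \<Longrightarrow> smooth_germ f"
  unfolding smooth_germ_def
  by (rule eventually_at_right_0I[of \<delta>]) (auto elim: smooth_curve_on_subset)

lemma smooth_germ_cong:
  assumes f: "smooth_germ f" and eq: "\<forall>\<^sub>F t in nhds 0. f t = g t"
  shows "smooth_germ g" and "ndv k g 0 = ndv k f 0"
proof -
  have "\<forall>\<^sub>F \<delta> in at_right 0. smooth_curve_on (ball 0 \<delta>) f \<and> (\<forall>t\<in>ball 0 \<delta>. f t = g t)"
    using f eventually_ball_at_right_0[OF eq] unfolding smooth_germ_def by (rule eventually_conj)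
  then obtain d where d: "d > 0" "smooth_curve_on (ball 0 d) f" "\<And>t. t \<in> ball 0 d \<Longrightarrow> f t = g t"
    by (rule eventually_at_right_0_obtain) auto
  note c = smooth_curve_on_cong[OF open_ball d(3) d(2)]
  show "smooth_germ g" using c(1) d(1) by (intro smooth_germI) auto
  show "ndv k g 0 = ndv k f 0" using c(2) d(1) by auto
qed

lemma smooth_germ_const [intro]: "smooth_germ (\<lambda>t. c)"
  by (rule smooth_germI[of 1]) (auto intro: smooth_curve_on_const)

lemma smooth_germ_add:
  assumes "smooth_germ f" "smooth_germ g"
  shows "smooth_germ (\<lambda>t. f t + g t)" and "ndv k (\<lambda>t. f t + g t) 0 = ndv k f 0 + ndv k g 0"
proof -
  have "\<forall>\<^sub>F \<delta> in at_right 0. smooth_curve_on (ball 0 \<delta>) f \<and> smooth_curve_on (ball 0 \<delta>) g"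
    using assms unfolding smooth_germ_def by (rule eventually_conj)
  then obtain d where d: "d > 0" "smooth_curve_on (ball 0 d) f" "smooth_curve_on (ball 0 d) g"
    by (rule eventually_at_right_0_obtain) auto
  note c = smooth_curve_on_add[OF open_ball d(2,3)]
  show "smooth_germ (\<lambda>t. f t + g t)" using c(1) d(1) by (rule smooth_germI[rotated])
  show "ndv k (\<lambda>t. f t + g t) 0 = ndv k f 0 + ndv k g 0" using c(2) d(1) by auto
qed

lemma smooth_germ_mult:
  assumes "smooth_germ f" "smooth_germ g"
  shows "smooth_germ (\<lambda>t. f t * g t)"
    and "ndv k (\<lambda>t. f t * g t) 0 = (\<Sum>j\<le>k. of_nat (k choose j) * (ndv j f 0 * ndv (k - j) g 0))"
proof -
  have "\<forall>\<^sub>F \<delta> in at_right 0. smooth_curve_on (ball 0 \<delta>) f \<and> smooth_curve_on (ball 0 \<delta>) g"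
    using assms unfolding smooth_germ_def by (rule eventually_conj)
  then obtain d where d: "d > 0" "smooth_curve_on (ball 0 d) f" "smooth_curve_on (ball 0 d) g"
    by (rule eventually_at_right_0_obtain) auto
  note c = smooth_curve_on_mult[OF open_ball d(2,3)]
  show "smooth_germ (\<lambda>t. f t * g t)" using c(1) d(1) by (rule smooth_germI[rotated])
  show "ndv k (\<lambda>t. f t * g t) 0 = (\<Sum>j\<le>k. of_nat (k choose j) * (ndv j f 0 * ndv (k - j) g 0))"
    using c(2) d(1) by auto
qed

lemma smooth_germ_power: "smooth_germ f \<Longrightarrow> smooth_germ (\<lambda>t. f t ^ n)"
  by (induction n) (auto intro: smooth_germ_mult)

lemma smooth_germ_sum:
  "(\<And>i. i \<in> I \<Longrightarrow> smooth_germ (f i)) \<Longrightarrow> smooth_germ (\<lambda>t. \<Sum>i\<in>I. f i t)"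
  by (induction I rule: infinite_finite_induct) (auto intro: smooth_germ_add)

lemma smooth_germ_of_real: "smooth_germ complex_of_real"
  and ndv_of_real: "ndv k complex_of_real 0 = (if k = 1 then 1 else 0)"
proof -
  note j = ndv_jet[of UNIV "\<lambda>k t. if k = 0 then complex_of_real t else if k = 1 then 1 else 0"
      complex_of_real, OF open_UNIV]
  have "smooth_curve_on UNIV complex_of_real"
    by (rule j) (auto intro!: derivative_eq_intros)
  then show "smooth_germ complex_of_real"
    by (intro smooth_germI[of 1]) (auto elim: smooth_curve_on_subset)
  have "ndv k complex_of_real 0 = (if k = 0 then complex_of_real 0 else if k = 1 then 1 else 0)"
    by (rule j) (auto intro!: derivative_eq_intros)
  then show "ndv k complex_of_real 0 = (if k = 1 then 1 else 0)" by simp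
qed

lemma ndv_of_real_mult:
  assumes "smooth_germ f"
  shows "ndv (Suc k) (\<lambda>t. of_real t * f t) 0 = of_nat (Suc k) * ndv k f 0"
proof -
  have "ndv (Suc k) (\<lambda>t. of_real t * f t) 0 =
      (\<Sum>j\<le>Suc k. if j = 1 then of_nat (Suc k) * ndv k f 0 else 0)"
    unfolding smooth_germ_mult(2)[OF smooth_germ_of_real assms]
    by (intro sum.cong) (auto simp: ndv_of_real)
  then show ?thesis by (simp add: sum.delta)
qed

lemma flat_at_0_mult:
  assumes "smooth_germ f" "smooth_germ g" "flat_at_0 f"
  shows "flat_at_0 (\<lambda>t. f t * g t)"
  using assms by (simp add: flat_at_0_def smooth_germ_mult(2))

lemma smooth_germ_isCont:
  assumes "smooth_germ f"
  shows "isCont f 0"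
proof -
  obtain d where "d > 0" "smooth_curve_on (ball 0 d) f"
    using assms unfolding smooth_germ_def by (rule eventually_at_right_0_obtain)
  then show ?thesis
    using has_vector_derivative_continuous smooth_curve_onD[of "ball 0 d" f 0 0] by auto
qed

text \<open>Cancelling a power of \<open>t\<close> gives identities only off the origin; continuity
  restores them at \<open>0\<close>.\<close>

lemma smooth_germ_eq_nhds:
  assumes "smooth_germ f" "smooth_germ g" "\<forall>\<^sub>F t in at 0. f t = g t"
  shows "\<forall>\<^sub>F t in nhds 0. f t = g t"
proof -
  have "(f \<longlongrightarrow> f 0) (at 0)" "(g \<longlongrightarrow> g 0) (at 0)"
    using assms(1,2)[THEN smooth_germ_isCont] by (auto simp: isCont_def)
  moreover have "(f \<longlongrightarrow> g 0) (at 0)"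
    using \<open>(g \<longlongrightarrow> g 0) (at 0)\<close> assms(3) by (simp add: tendsto_cong)
  ultimately have "f 0 = g 0" by (meson tendsto_unique trivial_limit_at)
  then show ?thesis using assms(3) by (simp add: eventually_nhds_conv_at)
qed

text \<open>Hadamard's quotient \<open>(f t - f 0) / t\<close>, smooth across \<open>t = 0\<close>.\<close>

definition hquot :: "(real \<Rightarrow> complex) \<Rightarrow> real \<Rightarrow> complex" where
  "hquot f t = integral (cbox 0 1) (\<lambda>s. ndv 1 f (t * s))"

lemma mult_mem_ball_0: "t \<in> ball (0::real) \<delta> \<Longrightarrow> s \<in> cbox 0 1 \<Longrightarrow> t * s \<in> ball 0 \<delta>"
  using mult_right_mono[of "\<bar>s\<bar>" 1 "\<bar>t\<bar>"] by (auto simp: abs_mult mult.commute)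

text \<open>Differentiation under the integral sign, each derivative bringing out one factor
  \<open>s\<close>. As \<open>s\<close> lies between \<open>0\<close> and \<open>1\<close>, the
  formula for \<open>ndv k\<close> turns bounds for derivatives of \<open>f\<close> of order
  \<open>Suc k\<close> into bounds for the quotient.\<close>

lemma hquot_jet:
  fixes \<delta> :: real and f :: "real \<Rightarrow> complex"
  assumes f: "smooth_curve_on (ball 0 \<delta>) f"
  defines "D \<equiv> \<lambda>k t. integral (cbox 0 1) (\<lambda>s. of_real s ^ k * ndv (Suc k) f (t * s))"
  shows "smooth_curve_on (ball 0 \<delta>) (hquot f)"
    and "\<And>k t. t \<in> ball 0 \<delta> \<Longrightarrow> ndv k (hquot f) t = D k t"
    and "\<And>k t. t \<in> ball 0 \<delta> \<Longrightarrow>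
      continuous_on (cbox 0 1) (\<lambda>s. of_real s ^ k * ndv (Suc k) f (t * s))"
proof -
  let ?U = "ball (0::real) \<delta>"
  have cont2: "continuous_on (?U \<times> cbox 0 1) (\<lambda>(t, s). of_real s ^ l * ndv k f (t * s))" for k l
  proof -
    have "continuous_on (?U \<times> cbox 0 1) (\<lambda>p. ndv k f (fst p * snd p))"
    proof (rule continuous_on_compose2[OF smooth_curve_on_continuous[OF f, of k]])
      show "(\<lambda>p. fst p * snd p) ` (?U \<times> cbox 0 1) \<subseteq> ?U"
        using mult_mem_ball_0 by fastforce
    qed (intro continuous_intros)
    then show ?thesis
      unfolding split_beta by (intro continuous_intros)
  qed
  show cont: "continuous_on (cbox 0 1) (\<lambda>s. of_real s ^ k * ndv (Suc k) f (t * s))"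
    if t: "t \<in> ?U" for k t
  proof -
    have "continuous_on (cbox 0 (1::real)) (Pair t)" by (intro continuous_intros)
    moreover have "Pair t ` cbox 0 (1::real) \<subseteq> ?U \<times> cbox 0 1" using t by auto
    ultimately show ?thesis
      using continuous_on_compose2[OF cont2, of "cbox 0 1" "Pair t" k "Suc k"] by simp
  qed
  have d: "(D k has_vector_derivative D (Suc k) t) (at t)" if t: "t \<in> ?U" for k t
  proof -
    have "(D k has_vector_derivative D (Suc k) t) (at t within ?U)"
      unfolding D_def
    proof (rule leibniz_rule_vector_derivative)
      fix x s :: real assume x: "x \<in> ?U" "s \<in> cbox 0 1"
      have "((\<lambda>x. x * s) has_vector_derivative s) (at x)"
        by (auto intro!: derivative_eq_intros)
      from vector_diff_chain_at[OF this smooth_curve_onD[OF f mult_mem_ball_0[OF x], of "Suc k"]]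
      have "((\<lambda>x. ndv (Suc k) f (x * s)) has_vector_derivative s *\<^sub>R ndv (Suc (Suc k)) f (x * s)) (at x)"
        by (simp add: o_def)
      from has_vector_derivative_mult_right[OF this, of "of_real s ^ k"]
      show "((\<lambda>x. of_real s ^ k * ndv (Suc k) f (x * s)) has_vector_derivative
          of_real s ^ Suc k * ndv (Suc (Suc k)) f (x * s)) (at x within ?U)"
        by (simp add: scaleR_conv_of_real mult_ac has_vector_derivative_at_within)
    next
      show "continuous_on (?U \<times> cbox 0 1) (\<lambda>(t, s). of_real s ^ Suc k * ndv (Suc (Suc k)) f (t * s))"
        by (rule cont2)
    qed (use t in \<open>auto intro!: integrable_continuous cont simp del: box_real\<close>)
    then show ?thesis using at_within_open[OF t open_ball] by simp
  qed
  have D0: "D 0 t = hquot f t" for t by (simp add: D_def hquot_def)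
  note j = ndv_jet[of ?U D "hquot f", OF open_ball D0 d]
  show "smooth_curve_on ?U (hquot f)" by (rule j)
  show "\<And>k t. t \<in> ?U \<Longrightarrow> ndv k (hquot f) t = D k t" by (rule j)
qed

lemma hquot_eq:
  assumes f: "smooth_curve_on (ball 0 \<delta>) f" and t: "t \<in> ball 0 \<delta>"
  shows "f t = f 0 + of_real t * hquot f t"
proof -
  have "((\<lambda>s. t *\<^sub>R ndv 1 f (t * s)) has_integral f (t * 1) - f (t * 0)) {0..1}"
  proof (rule fundamental_theorem_of_calculus)
    fix s :: real assume s: "s \<in> {0..1}"
    then have ts: "t * s \<in> ball 0 \<delta>" using mult_mem_ball_0[OF t, of s] by simp
    have "((\<lambda>s. t * s) has_vector_derivative t) (at s)"
      by (auto intro!: derivative_eq_intros)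
    from vector_diff_chain_at[OF this smooth_curve_onD[OF f ts, of 0]]
    show "((\<lambda>s. f (t * s)) has_vector_derivative t *\<^sub>R ndv 1 f (t * s)) (at s within {0..1})"
      by (simp add: o_def has_vector_derivative_at_within)
  qed simp
  from integral_unique[OF this] show ?thesis
    by (simp add: hquot_def scaleR_conv_of_real algebra_simps)
qed

lemma smooth_germ_hquot:
  assumes "smooth_germ f"
  shows "smooth_germ (hquot f)" and "\<forall>\<^sub>F t in nhds 0. f t = f 0 + of_real t * hquot f t"
proof -
  obtain d where d: "d > 0" "smooth_curve_on (ball 0 d) f"
    using assms unfolding smooth_germ_def by (rule eventually_at_right_0_obtain)
  show "smooth_germ (hquot f)" using d hquot_jet(1) smooth_germI by blast
  show "\<forall>\<^sub>F t in nhds 0. f t = f 0 + of_real t * hquot f t"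
    unfolding eventually_nhds_metric
    using d(1) by (intro exI[of _ d] conjI allI impI hquot_eq[OF d(2)]) (auto simp: dist_commute)
qed

text \<open>The induction may start at any order with non-zero derivative, not only at the least
  one: each division by \<open>t\<close> lowers it by one, and the process stops as soon as the
  value at \<open>0\<close> is non-zero.\<close>

lemma smooth_germ_factor:
  assumes "smooth_germ f" "\<not> flat_at_0 f"
  shows "\<exists>r u. smooth_germ u \<and> u 0 \<noteq> 0 \<and> (\<forall>\<^sub>F t in nhds 0. f t = of_real t ^ r * u t)"
proof -
  obtain n where "ndv n f 0 \<noteq> 0" using assms(2) by (auto simp: flat_at_0_def)
  then show ?thesis using assms(1)
  proof (induction n arbitrary: f)
    case 0
    then show ?case by (intro exI[of _ 0] exI[of _ f]) auto
  next
    case (Suc n)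
    show ?case
    proof (cases "f 0 = 0")
      case False
      then show ?thesis using Suc by (intro exI[of _ 0] exI[of _ f]) auto
    next
      case True
      note q = smooth_germ_hquot[OF Suc.prems(2)]
      have eq: "\<forall>\<^sub>F t in nhds 0. of_real t * hquot f t = f t" using q(2)
        by eventually_elim (simp add: True)
      have "ndv (Suc n) f 0 = of_nat (Suc n) * ndv n (hquot f) 0"
        using smooth_germ_cong(2)[OF smooth_germ_mult(1)[OF smooth_germ_of_real q(1)] eq]
        by (simp add: ndv_of_real_mult[OF q(1)])
      then have "ndv n (hquot f) 0 \<noteq> 0" using Suc.prems by auto
      then obtain r u where u: "smooth_germ u" "u 0 \<noteq> 0"
        "\<forall>\<^sub>F t in nhds 0. hquot f t = of_real t ^ r * u t"
        using Suc.IH q(1) by blast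
      have "\<forall>\<^sub>F t in nhds 0. f t = of_real t ^ Suc r * u t"
        using u(3) eq by eventually_elim (simp add: mult.assoc)
      then show ?thesis using u by blast
    qed
  qed
qed

lemma not_flat_eventually_nonzero:
  assumes "smooth_germ f" "\<not> flat_at_0 f"
  shows "\<forall>\<^sub>F t in at 0. f t \<noteq> 0"
proof -
  obtain r u where u: "smooth_germ u" "u 0 \<noteq> 0" "\<forall>\<^sub>F t in nhds 0. f t = of_real t ^ r * u t"
    using smooth_germ_factor[OF assms] by blast
  have "\<forall>\<^sub>F t in at 0. u t \<noteq> 0"
    using smooth_germ_isCont[OF u(1)] u(2) by (auto simp: isCont_def intro: tendsto_imp_eventually_ne)
  moreover have "\<forall>\<^sub>F t in at 0. f t = of_real t ^ r * u t"
    using u(3) by (simp add: eventually_nhds_conv_at)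
  moreover have "\<forall>\<^sub>F t in at 0. t \<noteq> (0::real)" by (simp add: eventually_at_filter)
  ultimately show ?thesis by eventually_elim simp
qed

context dc_weight
begin

lemma CM_germI: "\<delta> > 0 \<Longrightarrow> CM_curve_on (ball 0 \<delta>) f \<Longrightarrow> CM_germ f"
  unfolding CM_germ_def
  by (rule eventually_at_right_0I[of \<delta>]) (auto elim: CM_curve_on_subset)

lemma CM_germ_smooth: "CM_germ f \<Longrightarrow> smooth_germ f"
  unfolding CM_germ_def smooth_germ_def by (auto elim: eventually_mono intro: CM_curve_on_smooth)

lemma CM_germ_cong:
  assumes f: "CM_germ f" and eq: "\<forall>\<^sub>F t in nhds 0. f t = g t"
  shows "CM_germ g"
  using f eventually_ball_at_right_0[OF eq] unfolding CM_germ_def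
  by eventually_elim (auto intro: CM_curve_on_cong)

lemma CM_germ_const [intro]: "CM_germ (\<lambda>t. c)"
  by (rule CM_germI[of 1]) (auto intro: CM_curve_on_const)

lemma CM_germ_add: "CM_germ f \<Longrightarrow> CM_germ g \<Longrightarrow> CM_germ (\<lambda>t. f t + g t)"
  unfolding CM_germ_def
  by (elim eventually_rev_mp, intro always_eventually)
    (auto intro!: CM_curve_on_gen_alg gen_alg.add intro: gen_alg.base)

lemma CM_germ_mult: "CM_germ f \<Longrightarrow> CM_germ g \<Longrightarrow> CM_germ (\<lambda>t. f t * g t)"
  unfolding CM_germ_def
  by (elim eventually_rev_mp, intro always_eventually)
    (auto intro!: CM_curve_on_gen_alg gen_alg.mult intro: gen_alg.base)

lemma CM_germ_power: "CM_germ f \<Longrightarrow> CM_germ (\<lambda>t. f t ^ n)"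
  by (induction n) (auto intro: CM_germ_mult)

lemma CM_germ_sum: "(\<And>i. i \<in> I \<Longrightarrow> CM_germ (f i)) \<Longrightarrow> CM_germ (\<lambda>t. \<Sum>i\<in>I. f i t)"
  by (induction I rule: infinite_finite_induct) (auto intro: CM_germ_add)

text \<open>The identity is bounded on the unit ball and solves \<open>f' = 1\<close>.\<close>

lemma CM_germ_of_real: "CM_germ complex_of_real"
proof (rule CM_germI[of 1])
  show "CM_curve_on (ball 0 1) complex_of_real"
  proof (rule polynomial_ode_CM[of _ "{complex_of_real}"])
    fix f assume "f \<in> {complex_of_real}"
    then show "\<exists>C. \<forall>t\<in>ball 0 1. norm (f t) \<le> C"
      by (intro exI[of _ 1]) auto
    show "\<exists>g\<in>gen_alg ({complex_of_real} \<union> Collect (CM_curve_on (ball 0 1))).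
        \<forall>t\<in>ball 0 1. (f has_vector_derivative g t) (at t)"
      using \<open>f \<in> {complex_of_real}\<close>
      by (intro bexI[of _ "\<lambda>t. 1"])
        (auto intro!: derivative_eq_intros gen_alg.base CM_curve_on_const)
  qed auto
qed simp

lemma CM_germ_hquot:
  assumes "CM_germ f"
  shows "CM_germ (hquot f)"
proof -
  obtain d where d: "d > 0" "CM_curve_on (ball 0 d) f"
    using assms unfolding CM_germ_def by (rule eventually_at_right_0_obtain)
  then obtain C \<rho> where C: "C > 0" "\<rho> > 0"
    "\<And>k t. t \<in> ball 0 d \<Longrightarrow> norm (ndv k f t) \<le> C * \<rho> ^ k * fact k * M k"
    by (auto simp: CM_curve_on_def)
  obtain C' \<rho>' where C': "C' > 0" "\<rho>' > 0"
    "\<And>k. C * \<rho> ^ Suc k * fact (Suc k) * M (Suc k) \<le> C' * \<rho>' ^ k * fact k * M k"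
    using CM_bound_shift[OF C(1,2)] by blast
  note q = hquot_jet[OF CM_curve_on_smooth[OF d(2)]]
  have "norm (ndv k (hquot f) t) \<le> C' * \<rho>' ^ k * fact k * M k" if t: "t \<in> ball 0 d" for k t
  proof -
    let ?B = "C * \<rho> ^ Suc k * fact (Suc k) * M (Suc k)"
    have "norm (integral {0..1} (\<lambda>s. of_real s ^ k * ndv (Suc k) f (t * s))) \<le> ?B * (1 - 0)"
    proof (rule integral_bound)
      show "continuous_on {0..1} (\<lambda>s. of_real s ^ k * ndv (Suc k) f (t * s))"
        using q(3)[OF t, of k] by simp
      fix s :: real assume s: "s \<in> {0..1}"
      then have "t * s \<in> ball 0 d" using mult_mem_ball_0[OF t, of s] by simp
      have "norm (of_real s ^ k * ndv (Suc k) f (t * s)) = s ^ k * norm (ndv (Suc k) f (t * s))"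
        using s by (simp add: norm_mult norm_power)
      also have "\<dots> \<le> 1 * ?B"
        using s C(3)[OF \<open>t * s \<in> ball 0 d\<close>, of "Suc k"] by (intro mult_mono power_le_one) auto
      finally show "norm (of_real s ^ k * ndv (Suc k) f (t * s)) \<le> ?B" by simp
    qed simp
    also have "?B * (1 - 0) \<le> C' * \<rho>' ^ k * fact k * M k" using C'(3) by simp
    finally show ?thesis using q(2)[OF t, of k] by simp
  qed
  then have "CM_curve_on (ball 0 d) (hquot f)"
    using q(1) C' unfolding CM_curve_on_def by blast
  then show ?thesis using d(1) by (rule CM_germI[rotated])
qed

text \<open>One factor \<open>t\<close> is removed at a time by Hadamard's quotient, which preserves
  the class. Smoothness of \<open>s\<close> identifies that quotient with the expected one across
  \<open>0\<close>.\<close>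

lemma CM_germ_divide_power:
  assumes "CM_germ q" "smooth_germ s" "\<forall>\<^sub>F t in nhds 0. q t = of_real t ^ r * s t"
  shows "CM_germ s"
  using assms
proof (induction r arbitrary: q)
  case 0
  then show ?case by (auto elim: CM_germ_cong)
next
  case (Suc r)
  let ?s = "\<lambda>t. of_real t ^ r * s t"
  have s: "smooth_germ ?s"
    by (intro smooth_germ_mult smooth_germ_power smooth_germ_of_real Suc.prems)
  note h = smooth_germ_hquot[OF CM_germ_smooth[OF Suc.prems(1)]]
  have q0: "q 0 = 0" using eventually_nhds_x_imp_x[OF Suc.prems(3)] by simp
  have "\<forall>\<^sub>F t in at 0. hquot q t = ?s t"
    using h(2) Suc.prems(3) unfolding eventually_at_filter
    by eventually_elim (auto simp: q0)
  then have "\<forall>\<^sub>F t in nhds 0. hquot q t = ?s t"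
    by (rule smooth_germ_eq_nhds[OF h(1) s])
  then show ?case
    by (intro Suc.IH[of "hquot q"] CM_germ_hquot Suc.prems)
qed

end

section \<open>The Denjoy--Carleman theorem\<close>

lemma exp_partial_sum_le:
  fixes x :: real
  assumes "x \<ge> 0"
  shows "(\<Sum>j<n. x ^ j / fact j) \<le> exp x"
  unfolding exp_def using summable_exp[of x] assms
  by (auto intro!: sum_le_suminf simp: scaleR_conv_of_real field_simps)

text \<open>Interchanging the sums would use that the tail of \<open>1 / k\<^sup>2\<close> is of
  size \<open>1 / k\<close>. The second term on the left stands for that missing tail and makes the
  bound inductive; for \<open>n = 0\<close> it is zero by division by zero.\<close>

lemma Carleman_partial_sums:
  fixes a :: "nat \<Rightarrow> real"
  assumes "\<And>i. 0 \<le> a i"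
  shows "(\<Sum>k<n. (\<Sum>i\<le>k. real (Suc i) * a i) / (real (Suc k))\<^sup>2) + (\<Sum>i<n. real (Suc i) * a i) / real n
    \<le> 2 * (\<Sum>i<n. a i)"
proof (induction n)
  case (Suc n)
  define s where "s = (\<Sum>i<n. real (Suc i) * a i)"
  define T where "T = (\<Sum>k<n. (\<Sum>i\<le>k. real (Suc i) * a i) / (real (Suc k))\<^sup>2)"
  define A where "A = (\<Sum>i<n. a i)"
  have s: "s \<ge> 0" unfolding s_def by (intro sum_nonneg) (simp add: assms)
  have IH: "T + s / real n \<le> 2 * A" using Suc by (simp add: s_def T_def A_def)
  have "s * (1 / (real (Suc n))\<^sup>2 + 1 / real (Suc n)) \<le> s / real n"
  proof (cases "n = 0")
    case False
    define y where "y = real (Suc n)"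
    have "y > 0" "real n * (1 + y) \<le> y\<^sup>2"
      by (simp_all add: y_def power2_eq_square algebra_simps)
    then have "1 / y\<^sup>2 + 1 / y \<le> 1 / real n"
      using False by (simp add: field_simps power2_eq_square)
    from mult_left_mono[OF this s] show ?thesis by (simp add: y_def)
  qed (simp add: s_def)
  moreover have "real (Suc n) * a n * (1 / (real (Suc n))\<^sup>2 + 1 / real (Suc n)) \<le> 2 * a n"
  proof -
    have "real (Suc n) * (1 / (real (Suc n))\<^sup>2 + 1 / real (Suc n)) = 1 / real (Suc n) + 1"
      by (simp add: distrib_left power2_eq_square del: of_nat_Suc)
    also have "\<dots> \<le> 2" by simp
    finally have "real (Suc n) * (1 / (real (Suc n))\<^sup>2 + 1 / real (Suc n)) * a n \<le> 2 * a n"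
      by (rule mult_right_mono) (rule assms)
    then show ?thesis by (simp only: mult_ac)
  qed
  ultimately have "T + (s + real (Suc n) * a n) / (real (Suc n))\<^sup>2 + (s + real (Suc n) * a n) / real (Suc n)
      \<le> 2 * (A + a n)"
    using IH by (simp only: distrib_left add_divide_distrib distrib_right times_divide_eq_right mult_1_right)
  then show ?case
    by (simp add: s_def T_def A_def lessThan_Suc_atMost[symmetric] del: of_nat_Suc)
qed simp

text \<open>The arithmetic-geometric mean inequality is applied to
  \<open>real (Suc i) * a i\<close>, which is better balanced than \<open>a i\<close>. The factorial
  so introduced is removed by the root bound \<open>fact m powr (1 / m) \<ge> m / exp 1\<close> for
  \<open>m = Suc k\<close>.\<close>

lemma Carleman_summable:
  fixes a :: "nat \<Rightarrow> real"
  assumes pos: "\<And>i. 0 < a i" and sm: "summable a"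
  shows "summable (\<lambda>k. (\<Prod>i\<le>k. a i) powr (1 / real (Suc k)))"
proof -
  let ?g = "\<lambda>k. (\<Sum>i\<le>k. real (Suc i) * a i) / (real (Suc k))\<^sup>2"
  have g0: "0 \<le> ?g k" for k
    using pos by (intro divide_nonneg_nonneg sum_nonneg) (auto simp: less_imp_le)
  have "(\<Sum>k<n. ?g k) \<le> 2 * suminf a" for n
  proof -
    have "0 \<le> (\<Sum>i<n. real (Suc i) * a i) / real n"
      using pos by (intro divide_nonneg_nonneg sum_nonneg) (auto simp: less_imp_le)
    then have "(\<Sum>k<n. ?g k) \<le> 2 * (\<Sum>i<n. a i)"
      using Carleman_partial_sums[of a n] pos by (smt (verit) less_imp_le)
    also have "\<dots> \<le> 2 * suminf a"
      using sum_le_suminf[OF sm, of "{..<n}"] pos by (simp add: less_imp_le)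
    finally show ?thesis .
  qed
  then have g: "summable (\<lambda>k. exp 1 * ?g k)"
    using g0 by (intro summable_mult summableI_nonneg_bounded[of _ "2 * suminf a"])
  have "(\<Prod>i\<le>k. a i) powr (1 / real (Suc k)) \<le> exp 1 * ?g k" for k
  proof -
    let ?m = "real (Suc k)"
    let ?x = "\<lambda>i. real (Suc i) * a i"
    have fac: "(\<Prod>i\<le>k. real (Suc i)) = fact (Suc k)"
      by (simp add: fact_prod_Suc atLeast0LessThan lessThan_Suc_atMost)
    \<comment> \<open>The left side is a single term of the exponential series at
      \<open>?m\<close>.\<close>
    have "?m ^ Suc k / fact (Suc k) \<le> (\<Sum>j<Suc (Suc k). ?m ^ j / fact j)"
      by (rule member_le_sum) auto
    also have "\<dots> \<le> exp ?m" by (rule exp_partial_sum_le) simp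
    finally have "(?m / exp 1) ^ Suc k \<le> fact (Suc k)"
      by (simp add: field_simps exp_of_nat_mult[symmetric] power_divide del: power_Suc of_nat_Suc fact_Suc)
    then have "((?m / exp 1) ^ Suc k) powr (1 / ?m) \<le> fact (Suc k) powr (1 / ?m)"
      by (intro powr_mono2) auto
    then have f: "?m / exp 1 \<le> fact (Suc k) powr (1 / ?m)"
      by (simp add: powr_realpow[symmetric] powr_powr del: power_Suc of_nat_Suc fact_Suc)
    have am: "(\<Prod>i\<le>k. ?x i) powr (1 / ?m) \<le> (\<Sum>i\<le>k. ?x i) / ?m"
      using arith_geom_mean[of "{..k}" ?x] pos by (simp add: less_imp_le sum_divide_distrib)
    have "(\<Prod>i\<le>k. ?x i) = fact (Suc k) * (\<Prod>i\<le>k. a i)"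
      by (simp only: prod.distrib fac)
    then have "fact (Suc k) powr (1 / ?m) * (\<Prod>i\<le>k. a i) powr (1 / ?m) \<le> (\<Sum>i\<le>k. ?x i) / ?m"
      using am by (simp add: powr_mult del: fact_Suc of_nat_Suc)
    moreover have "?m / exp 1 * (\<Prod>i\<le>k. a i) powr (1 / ?m) \<le>
        fact (Suc k) powr (1 / ?m) * (\<Prod>i\<le>k. a i) powr (1 / ?m)"
      by (rule mult_right_mono[OF f]) simp
    ultimately have "?m / exp 1 * (\<Prod>i\<le>k. a i) powr (1 / ?m) \<le> (\<Sum>i\<le>k. ?x i) / ?m"
      by linarith
    then have "(exp 1 / ?m) * (?m / exp 1 * (\<Prod>i\<le>k. a i) powr (1 / ?m)) \<le> (exp 1 / ?m) * ((\<Sum>i\<le>k. ?x i) / ?m)"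
      by (rule mult_left_mono) simp
    then show ?thesis by (simp add: power2_eq_square del: of_nat_Suc)
  qed
  then show ?thesis
    by (intro summable_comparison_test'[OF g, of 0]) simp
qed

text \<open>Bang's argument: if all \<open>\<bar>D n x\<bar> \<le> e\<^sup>n\<^sup>-\<^sup>q\<^sup>-\<^sup>1 N n\<close>, then moving by at most
  \<open>N q / (e N (q + 1))\<close> costs only one factor \<open>e\<close>. Starting from a flat point with \<open>q\<close> arbitrarily
  large, divergence of \<open>\<Sum> N q / N (q + 1)\<close> permits to reach every other point.\<close>

locale bang =
  fixes N :: "nat \<Rightarrow> real" and D :: "nat \<Rightarrow> real \<Rightarrow> real" and \<delta> :: real
  assumes N_pos: "0 < N k"
    and N_log_convex: "(N (Suc k))\<^sup>2 \<le> N k * N (Suc (Suc k))"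
    and D_deriv: "t \<in> ball 0 \<delta> \<Longrightarrow> (D k has_real_derivative D (Suc k) t) (at t)"
    and D_bound: "t \<in> ball 0 \<delta> \<Longrightarrow> \<bar>D k t\<bar> \<le> N k"
begin

definition bang_bound :: "real \<Rightarrow> nat \<Rightarrow> bool" where
  "bang_bound x q \<longleftrightarrow> (\<forall>n. \<bar>D n x\<bar> \<le> exp (real n - real q) * N n)"

lemma N_ratio_le: "n \<le> q \<Longrightarrow> N (Suc n) / N n \<le> N (Suc q) / N q"
proof (induction q rule: dec_induct)
  case (step q)
  have "N (Suc q) / N q \<le> N (Suc (Suc q)) / N (Suc q)"
    using N_log_convex[of q] N_pos[of q] N_pos[of "Suc q"] by (simp add: field_simps power2_eq_square)
  with step show ?case by linarith
qed simp

lemma N_add_le: "n + j \<le> Suc q \<Longrightarrow> N (n + j) \<le> N n * (N (Suc q) / N q) ^ j"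
proof (induction j)
  case (Suc j)
  have "N (n + Suc j) = N (n + j) * (N (Suc (n + j)) / N (n + j))"
    using N_pos[of "n + j"] by simp
  also have "\<dots> \<le> (N n * (N (Suc q) / N q) ^ j) * (N (Suc q) / N q)"
    using Suc N_ratio_le[of "n + j" q] N_pos by (intro mult_mono) (auto simp: less_imp_le)
  finally show ?case by (simp add: mult_ac)
qed simp

text \<open>Taylor's formula at \<open>x\<close>. By log-convexity \<open>N (n + j)\<close> is at
  most \<open>N n * L ^ j\<close> with \<open>L = N (Suc q) / N q\<close>, and the step size makes
  \<open>exp 1 * L * \<bar>y - x\<bar>\<close> at most \<open>1\<close>. Hence the
  \<open>j\<close>-th term is at most \<open>?E / fact j\<close>, and the exponential series adds
  these up to the loss of one factor \<open>exp 1\<close>. Orders above \<open>q\<close> need only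
  the global bound.\<close>

lemma bang_bound_step:
  assumes x: "x \<in> ball 0 \<delta>" "bang_bound x (Suc q)" and y: "y \<in> ball 0 \<delta>"
    and h: "\<bar>y - x\<bar> \<le> exp (-1) * (N q / N (Suc q))"
  shows "bang_bound y q"
  unfolding bang_bound_def
proof
  fix n
  show "\<bar>D n y\<bar> \<le> exp (real n - real q) * N n"
  proof (cases "n \<le> q \<and> y \<noteq> x")
    case False
    then consider "n \<ge> Suc q" | "y = x" by linarith
    then show ?thesis
    proof cases
      case 1
      have "\<bar>D n y\<bar> \<le> 1 * N n" using D_bound[OF y] by simp
      also have "\<dots> \<le> exp (real n - real q) * N n"
        using 1 N_pos[of n] by (intro mult_right_mono) auto
      finally show ?thesis .
    next
      case 2
      have "\<bar>D n x\<bar> \<le> exp (real n - real (Suc q)) * N n"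
        using x(2) by (simp add: bang_bound_def del: of_nat_Suc)
      also have "\<dots> \<le> exp (real n - real q) * N n"
        using N_pos[of n] by (intro mult_right_mono) auto
      finally show ?thesis using 2 by simp
    qed
  next
    case True
    \<comment> \<open>With this order the remainder involves \<open>D (Suc q)\<close>, for which the
      required weight is \<open>exp 0\<close>, so the global bound suffices at the unknown
      point.\<close>
    define m where "m = Suc q - n"
    have m: "m > 0" "n + m = Suc q" using True by (auto simp: m_def)
    define L where "L = N (Suc q) / N q"
    have L: "L > 0" using N_pos by (simp add: L_def)
    have seg: "{min x y..max x y} \<subseteq> ball 0 \<delta>" using x(1) y by auto
    have "\<exists>\<xi>. (if y < x then y < \<xi> \<and> \<xi> < x else x < \<xi> \<and> \<xi> < y) \<and>
        D n y = (\<Sum>j<m. D (n + j) x / fact j * (y - x) ^ j) + D (n + m) \<xi> / fact m * (y - x) ^ m"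
    proof (rule Taylor[where diff = "\<lambda>j. D (n + j)" and a = "min x y" and b = "max x y"])
      show "\<forall>j t. j < m \<and> min x y \<le> t \<and> t \<le> max x y \<longrightarrow>
          (D (n + j) has_real_derivative D (n + Suc j) t) (at t)"
        using D_deriv seg by auto
    qed (use m True in auto)
    then obtain \<xi> where "if y < x then y < \<xi> \<and> \<xi> < x else x < \<xi> \<and> \<xi> < y"
      and eq: "D n y = (\<Sum>j<m. D (n + j) x / fact j * (y - x) ^ j) + D (n + m) \<xi> / fact m * (y - x) ^ m"
      by blast
    then have "\<xi> \<in> {min x y..max x y}" by (auto split: if_splits)
    then have \<xi>: "\<xi> \<in> ball 0 \<delta>" using seg by blast
    let ?E = "exp (real n - real (Suc q)) * N n"
    have Lh: "exp 1 * L * \<bar>y - x\<bar> \<le> 1"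
    proof -
      have "exp 1 * L * \<bar>y - x\<bar> \<le> exp 1 * L * (exp (-1) * (N q / N (Suc q)))"
        using L h by (intro mult_left_mono) auto
      also have "\<dots> = 1"
        using N_pos[of q] N_pos[of "Suc q"] by (simp add: L_def exp_minus)
      finally show ?thesis .
    qed
    have key: "\<bar>z / fact j * (y - x) ^ j\<bar> \<le> ?E * (1 / fact j)"
      if z: "\<bar>z\<bar> \<le> exp (real (n + j) - real (Suc q)) * N (n + j)" and j: "j \<le> m" for z j
    proof -
      have "\<bar>z\<bar> \<le> exp (real (n + j) - real (Suc q)) * (N n * L ^ j)"
        using z N_add_le[of n j q] m j unfolding L_def
        by (smt (verit, best) add_left_mono exp_gt_zero mult_left_mono)
      also have "\<dots> = ?E * (exp 1 * L) ^ j"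
        by (simp add: exp_diff exp_add power_mult_distrib exp_of_nat_mult[symmetric] field_simps)
      finally have "\<bar>z\<bar> * \<bar>y - x\<bar> ^ j \<le> ?E * (exp 1 * L) ^ j * \<bar>y - x\<bar> ^ j"
        by (rule mult_right_mono) simp
      also have "\<dots> = ?E * (exp 1 * L * \<bar>y - x\<bar>) ^ j"
        by (simp add: power_mult_distrib)
      also have "\<dots> \<le> ?E * 1"
        using Lh L N_pos[of n] by (intro mult_left_mono power_le_one) auto
      finally have "\<bar>z\<bar> * \<bar>y - x\<bar> ^ j / fact j \<le> ?E * 1 / fact j"
        by (rule divide_right_mono) simp
      then show ?thesis by (simp add: abs_mult power_abs)
    qed
    have "\<bar>D n y\<bar> \<le> (\<Sum>j<m. \<bar>D (n + j) x / fact j * (y - x) ^ j\<bar>) + \<bar>D (n + m) \<xi> / fact m * (y - x) ^ m\<bar>"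
      unfolding eq by (intro order_trans[OF abs_triangle_ineq] add_mono sum_abs order_refl)
    also have "\<dots> \<le> (\<Sum>j<m. ?E * (1 / fact j)) + ?E * (1 / fact m)"
    proof (intro add_mono sum_mono)
      fix j assume "j \<in> {..<m}"
      then show "\<bar>D (n + j) x / fact j * (y - x) ^ j\<bar> \<le> ?E * (1 / fact j)"
        using x(2) by (intro key) (auto simp: bang_bound_def simp del: of_nat_Suc of_nat_add)
    next
      show "\<bar>D (n + m) \<xi> / fact m * (y - x) ^ m\<bar> \<le> ?E * (1 / fact m)"
        using D_bound[OF \<xi>, of "n + m"] by (intro key) (simp_all add: m(2) del: of_nat_Suc)
    qed
    also have "\<dots> = ?E * (\<Sum>j<Suc m. 1 ^ j / fact j)"
      by (simp add: sum_distrib_left distrib_left)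
    also have "\<dots> \<le> ?E * exp 1"
      using N_pos[of n] by (intro mult_left_mono exp_partial_sum_le) auto
    also have "\<dots> = exp (real n - real q) * N n"
      by (simp add: exp_diff exp_add)
    finally show ?thesis .
  qed
qed

lemma bang_bound_reach:
  assumes flat: "\<And>k. D k 0 = 0" and qQ: "q \<le> Q"
    and x: "x \<in> ball 0 \<delta>" "\<bar>x\<bar> \<le> exp (-1) * (\<Sum>i=q..<Q. N i / N (Suc i))"
  shows "bang_bound x q"
  using qQ x
proof (induction q arbitrary: x rule: inc_induct)
  case base
  then have "x = 0" by simp
  then show ?case using flat N_pos by (simp add: bang_bound_def less_imp_le)
next
  case (step q)
  define s where "s = exp (-1) * (\<Sum>i=Suc q..<Q. N i / N (Suc i))"
  have s: "s \<ge> 0" unfolding s_def using N_pos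
    by (intro mult_nonneg_nonneg sum_nonneg divide_nonneg_nonneg) (auto simp: less_imp_le)
  \<comment> \<open>\<open>x\<close> is pulled back towards \<open>0\<close> to within the reach
    available at stage \<open>Suc q\<close>; what is left of the way is at most one step.\<close>
  define x' where "x' = sgn x * min \<bar>x\<bar> s"
  have x's: "\<bar>x'\<bar> \<le> s" "\<bar>x'\<bar> \<le> \<bar>x\<bar>" "\<bar>x - x'\<bar> = \<bar>x\<bar> - min \<bar>x\<bar> s"
    using s by (auto simp: x'_def sgn_if min_def)
  then have "x' \<in> ball 0 \<delta>" using step.prems by simp
  moreover have "bang_bound x' (Suc q)"
    using step.IH[of x'] x's(1) \<open>x' \<in> ball 0 \<delta>\<close> by (simp add: s_def)
  moreover have "\<bar>x - x'\<bar> \<le> exp (-1) * (N q / N (Suc q))"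
  proof -
    have "\<bar>x\<bar> \<le> exp (-1) * (N q / N (Suc q)) + s"
      using step.prems(2) step.hyps by (simp add: s_def sum.atLeast_Suc_lessThan distrib_left)
    moreover have "0 \<le> exp (-1) * (N q / N (Suc q))"
      using N_pos by (simp add: less_imp_le)
    ultimately show ?thesis using x's(3) by (auto simp: min_def)
  qed
  ultimately show ?case using step.prems(1) by (intro bang_bound_step[of x' q x])
qed

text \<open>If the bound failed at \<open>x\<close> for some \<open>q\<close>, then \<open>x\<close>
  would be out of reach from every \<open>Q\<close>, which bounds all partial sums of the ratios
  from \<open>q\<close> on. So it holds for all \<open>q\<close>, and \<open>q\<close> tends to
  infinity.\<close>

lemma flat_imp_zero:
  assumes flat: "\<And>k. D k 0 = 0" and ns: "\<not> summable (\<lambda>i. N i / N (Suc i))"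
    and x: "x \<in> ball 0 \<delta>"
  shows "D 0 x = 0"
proof -
  have a0: "0 \<le> N i / N (Suc i)" for i using N_pos by (simp add: less_imp_le)
  have "bang_bound x q" for q
  proof (rule ccontr)
    assume nb: "\<not> bang_bound x q"
    have "(\<Sum>i<n. N (i + q) / N (Suc (i + q))) \<le> exp 1 * \<bar>x\<bar>" for n
    proof -
      have "\<not> \<bar>x\<bar> \<le> exp (-1) * (\<Sum>i=q..<n + q. N i / N (Suc i))"
        using nb bang_bound_reach[OF flat, of q "n + q" x] x by auto
      moreover have "(\<Sum>i=q..<n + q. N i / N (Suc i)) = (\<Sum>i<n. N (i + q) / N (Suc (i + q)))"
        using sum.shift_bounds_nat_ivl[of "\<lambda>i. N i / N (Suc i)" 0 q n] by (simp add: atLeast0LessThan)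
      ultimately show ?thesis by (simp add: exp_minus field_simps)
    qed
    then have "summable (\<lambda>i. N (i + q) / N (Suc (i + q)))"
      using a0 by (intro summableI_nonneg_bounded)
    then show False using ns summable_iff_shift[of "\<lambda>i. N i / N (Suc i)" q] by simp
  qed
  then have le: "\<bar>D 0 x\<bar> \<le> exp (- real q) * N 0" for q
    by (metis bang_bound_def diff_0 of_nat_0)
  have "(\<lambda>q. exp (- real q) * N 0) \<longlonglongrightarrow> 0 * N 0"
    by (intro tendsto_mult tendsto_const filterlim_compose[OF exp_at_bot]
        filterlim_compose[OF filterlim_uminus_at_bot_at_top] filterlim_real_sequentially)
  then have "\<bar>D 0 x\<bar> \<le> 0 * N 0"
    using le by (intro LIMSEQ_le_const) auto
  then show ?thesis by simp
qed

end

context dc_weight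
begin

text \<open>Bang's argument consumes ratios, whereas \<open>quasianalytic\<close> speaks of roots.
  The product of ratios telescopes, so these roots are geometric means of ratios and Carleman's
  inequality carries summability over. \<open>C\<close> cancels and \<open>\<rho>\<close> only
  rescales.\<close>

lemma quasianalytic_ratio_not_summable:
  assumes "quasianalytic M" "\<rho> > 0" "C > 0"
  defines "N \<equiv> \<lambda>k. C * \<rho> ^ k * fact k * M k"
  shows "\<not> summable (\<lambda>k. N k / N (Suc k))"
proof
  assume "summable (\<lambda>k. N k / N (Suc k))"
  then have "summable (\<lambda>k. \<rho> * (N k / N (Suc k)))" by (rule summable_mult)
  moreover have "\<rho> * (N k / N (Suc k)) = fact k * M k / (fact (Suc k) * M (Suc k))" for k
    using assms(2,3) by (simp add: N_def field_simps del: fact_Suc)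
  ultimately have "summable (\<lambda>k. fact k * M k / (fact (Suc k) * M (Suc k)))" by simp
  then have "summable (\<lambda>k. (\<Prod>i\<le>k. fact i * M i / (fact (Suc i) * M (Suc i))) powr (1 / real (Suc k)))"
    by (intro Carleman_summable) auto
  moreover have "(\<Prod>i\<le>k. fact i * M i / (fact (Suc i) * M (Suc i))) = 1 / (fact (Suc k) * M (Suc k))" for k
  proof (induction k)
    case (Suc k)
    have "fact (Suc k) * M (Suc k) \<noteq> 0" by (simp del: fact_Suc)
    then show ?case using Suc by (simp del: fact_Suc)
  qed simp
  moreover have "(1 / (fact (Suc k) * M (Suc k))) powr (1 / real (Suc k)) =
      (fact (Suc k) * M (Suc k)) powr (- 1 / real (Suc k))" for k
  proof -
    have "0 < fact (Suc k) * M (Suc k)" by (intro mult_pos_pos fact_gt_zero M_pos)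
    then show ?thesis by (simp add: powr_divide powr_minus_divide del: fact_Suc of_nat_Suc)
  qed
  ultimately show False using assms(1) unfolding quasianalytic_def by simp
qed

lemma Denjoy_Carleman:
  assumes qa: "quasianalytic M" and f: "CM_curve_on (ball 0 \<delta>) f"
    and flat: "\<And>k. ndv k f 0 = 0" and t: "t \<in> ball 0 \<delta>"
  shows "f t = 0"
proof -
  obtain C \<rho> where C: "C > 0" "\<rho> > 0"
    "\<And>k t. t \<in> ball 0 \<delta> \<Longrightarrow> norm (ndv k f t) \<le> C * \<rho> ^ k * fact k * M k"
    using f by (auto simp: CM_curve_on_def)
  define N where "N = (\<lambda>k. C * \<rho> ^ k * fact k * M k)"
  \<comment> \<open>The weights and the factorials are both log-convex; the latter contribute
    \<open>Suc k \<le> Suc (Suc k)\<close>. \<open>K\<close> collects the common factors.\<close>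
  have lc: "(N (Suc k))\<^sup>2 \<le> N k * N (Suc (Suc k))" for k
  proof -
    have "(M (Suc k))\<^sup>2 \<le> M k * M (Suc (Suc k))"
      using M_log_convex[of "Suc k"] by simp
    then have "real (Suc k) * (M (Suc k))\<^sup>2 \<le> real (Suc (Suc k)) * (M k * M (Suc (Suc k)))"
      by (intro mult_mono) auto
    moreover define K where "K = C * C * (\<rho> ^ k * \<rho> ^ k * \<rho> * \<rho>) * (fact k * fact (Suc k))"
    moreover have "K \<ge> 0" using C by (simp add: K_def)
    ultimately have "K * (real (Suc k) * (M (Suc k))\<^sup>2) \<le> K * (real (Suc (Suc k)) * (M k * M (Suc (Suc k))))"
      by (intro mult_left_mono)
    moreover have "(N (Suc k))\<^sup>2 = K * (real (Suc k) * (M (Suc k))\<^sup>2)"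
      by (simp add: N_def K_def power2_eq_square mult_ac)
    moreover have "N k * N (Suc (Suc k)) = K * (real (Suc (Suc k)) * (M k * M (Suc (Suc k))))"
      by (simp add: N_def K_def mult_ac)
    ultimately show ?thesis by linarith
  qed
  have ns: "\<not> summable (\<lambda>k. N k / N (Suc k))"
    unfolding N_def by (rule quasianalytic_ratio_not_summable[OF qa C(2,1)])
  note sm = CM_curve_on_smooth[OF f]
  \<comment> \<open>The Taylor remainder at an intermediate point is a statement on real functions,
    so the two parts are treated separately with the same \<open>N\<close>.\<close>
  interpret re: bang N "\<lambda>k t. Re (ndv k f t)" \<delta>
    using C lc sm
    by unfold_locales (auto simp: N_def smooth_curve_on_def has_vector_derivative_complex_iff
        intro: order_trans[OF abs_Re_le_cmod])
  interpret im: bang N "\<lambda>k t. Im (ndv k f t)" \<delta>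
    using C lc sm
    by unfold_locales (auto simp: N_def smooth_curve_on_def has_vector_derivative_complex_iff
        intro: order_trans[OF abs_Im_le_cmod])
  show ?thesis
    using re.flat_imp_zero[OF _ ns t] im.flat_imp_zero[OF _ ns t] flat by (simp add: complex_eq_iff)
qed

end

section \<open>Smooth roots of polynomials over the class\<close>

text \<open>Summation runs to a bound \<open>d\<close> because the degree may jump along a curve of
  polynomials.\<close>

lemma poly_eq_sum_le:
  fixes p :: "'a :: idom poly"
  assumes "degree p \<le> d"
  shows "poly p x = (\<Sum>i\<le>d. coeff p i * x ^ i)"
    and "poly (pderiv p) x = (\<Sum>i\<le>d. coeff p i * (of_nat i * x ^ (i - 1)))"
proof -
  note p = poly_as_sum_of_monoms'[OF assms, symmetric]
  show "poly p x = (\<Sum>i\<le>d. coeff p i * x ^ i)"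
    by (subst p) (simp add: poly_sum poly_monom)
  have "pderiv (sum q A) = (\<Sum>i\<in>A. pderiv (q i))" for q :: "nat \<Rightarrow> 'a poly" and A
    by (induction A rule: infinite_finite_induct) (auto simp: pderiv_add)
  then have "pderiv p = (\<Sum>i\<le>d. monom (of_nat i * coeff p i) (i - 1))"
    by (subst p) (simp add: pderiv_monom)
  then show "poly (pderiv p) x = (\<Sum>i\<le>d. coeff p i * (of_nat i * x ^ (i - 1)))"
    by (simp add: poly_sum poly_monom mult_ac)
qed

lemma coeff_pcompose_translate:
  fixes p :: "complex poly"
  assumes "degree p \<le> d"
  shows "coeff (pcompose p [:a, 1:]) j = (\<Sum>i\<le>d. coeff p i * (of_nat (i choose j) * a ^ (i - j)))"
proof -
  have "poly (pcompose p [:a, 1:]) = poly (\<Sum>i\<le>d. smult (coeff p i) ([:a, 1:] ^ i))"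
    by (rule ext) (simp add: poly_pcompose poly_sum poly_eq_sum_le(1)[OF assms])
  then have "pcompose p [:a, 1:] = (\<Sum>i\<le>d. smult (coeff p i) ([:a, 1:] ^ i))"
    by (simp add: poly_eq_poly_eq_iff)
  moreover have "coeff ([:a, 1:] ^ i) j = of_nat (i choose j) * a ^ (i - j)" for i
  proof (cases "j \<le> i")
    case False
    then have "degree ([:a, 1:] ^ i) < j" using degree_power_le[of "[:a, 1:]" i] by simp
    then show ?thesis using False by (simp add: coeff_eq_0 binomial_eq_0)
  qed (simp add: coeff_linear_poly_power)
  ultimately show ?thesis by (simp add: coeff_sum)
qed

lemma poly_shift_Suc_0: "poly p x = coeff p 0 + x * poly (poly_shift 1 p) x"
proof -
  have "p = pCons (coeff p 0) (poly_shift 1 p)"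
    by (rule poly_eqI) (simp add: coeff_pCons coeff_poly_shift split: nat.splits)
  then show ?thesis by (metis poly_pCons)
qed

lemma degree_poly_shift_le: "degree (poly_shift n p) \<le> degree p"
  by (rule degree_le) (simp add: coeff_poly_shift coeff_eq_0)

context dc_weight
begin

definition CM_poly :: "(real \<Rightarrow> complex poly) \<Rightarrow> bool" where
  "CM_poly W \<longleftrightarrow> (\<forall>j. CM_germ (\<lambda>t. coeff (W t) j)) \<and> (\<exists>d. \<forall>t. degree (W t) \<le> d)"

lemma CM_poly_translate:
  assumes "CM_poly W" "CM_germ p"
  shows "CM_poly (\<lambda>t. pcompose (W t) [:p t, 1:])"
proof -
  obtain d where d: "\<And>t. degree (W t) \<le> d" and W: "\<And>j. CM_germ (\<lambda>t. coeff (W t) j)"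
    using assms by (auto simp: CM_poly_def)
  have "CM_germ (\<lambda>t. coeff (pcompose (W t) [:p t, 1:]) j)" for j
    unfolding coeff_pcompose_translate[OF d]
    by (intro CM_germ_sum CM_germ_mult CM_germ_power CM_germ_const W assms)
  then show ?thesis using d by (auto simp: CM_poly_def degree_pcompose)
qed

lemma CM_poly_scale:
  assumes "CM_poly W" "CM_germ a"
  shows "CM_poly (\<lambda>t. pcompose (W t) [:0, a t:])"
proof -
  obtain d where d: "\<And>t. degree (W t) \<le> d" and W: "\<And>j. CM_germ (\<lambda>t. coeff (W t) j)"
    using assms by (auto simp: CM_poly_def)
  have "degree (pcompose (W t) [:0, a t:]) \<le> d" for t
    using d[of t] by (simp add: degree_pcompose)
  then show ?thesis using W assms(2)
    by (auto simp: CM_poly_def coeff_pcompose_linear intro!: CM_germ_mult CM_germ_power)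
qed

lemma CM_poly_pCons:
  assumes "CM_germ a" "CM_poly W"
  shows "CM_poly (\<lambda>t. pCons (a t) (W t))"
proof -
  obtain d where d: "\<And>t. degree (W t) \<le> d" and W: "\<And>j. CM_germ (\<lambda>t. coeff (W t) j)"
    using assms by (auto simp: CM_poly_def)
  have "degree (pCons (a t) (W t)) \<le> Suc d" for t
    using d[of t] degree_pCons_le[of "a t" "W t"] by simp
  moreover have "CM_germ (\<lambda>t. coeff (pCons (a t) (W t)) j)" for j
    using W assms(1) by (cases j) auto
  ultimately show ?thesis unfolding CM_poly_def by blast
qed

lemma CM_poly_smult:
  assumes "CM_germ a" "CM_poly W"
  shows "CM_poly (\<lambda>t. smult (a t) (W t))"
  using assms by (auto simp: CM_poly_def intro!: CM_germ_mult intro: order_trans[OF degree_smult_le])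

lemma CM_poly_shift:
  assumes "CM_poly W"
  shows "CM_poly (\<lambda>t. poly_shift n (W t))"
  using assms by (auto simp: CM_poly_def coeff_poly_shift intro: order_trans[OF degree_poly_shift_le])

lemma CM_poly_pderiv:
  assumes "CM_poly W"
  shows "CM_poly (\<lambda>t. pderiv (W t))"
proof -
  obtain d where d: "\<And>t. degree (W t) \<le> d" and W: "\<And>j. CM_germ (\<lambda>t. coeff (W t) j)"
    using assms by (auto simp: CM_poly_def)
  have "degree (pderiv (W t)) \<le> d" for t using d[of t] by (simp add: degree_pderiv)
  then show ?thesis using W
    by (auto simp: CM_poly_def coeff_pderiv simp del: of_nat_Suc intro!: CM_germ_mult)
qed

lemma smooth_germ_poly:
  assumes "CM_poly W" "smooth_germ g"
  shows "smooth_germ (\<lambda>t. poly (W t) (g t))"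
proof -
  obtain d where d: "\<And>t. degree (W t) \<le> d" and W: "\<And>j. CM_germ (\<lambda>t. coeff (W t) j)"
    using assms by (auto simp: CM_poly_def)
  show ?thesis
    unfolding poly_eq_sum_le(1)[OF d]
    by (intro smooth_germ_sum smooth_germ_mult smooth_germ_power CM_germ_smooth W assms)
qed

text \<open>With \<open>w = 1 / \<partial>\<^sub>yZ(t, g)\<close>, the pair \<open>(g, w)\<close> solves the polynomial system
  \<open>g' = - w \<partial>\<^sub>tZ(t, g)\<close>, \<open>w' = - w\<^sup>2 (\<partial>\<^sub>yZ(t, g))'\<close>.\<close>

lemma simple_root_CM:
  assumes Z: "CM_poly Z" and g: "smooth_germ g"
    and zero: "\<forall>\<^sub>F t in nhds 0. poly (Z t) (g t) = 0"
    and simple: "poly (pderiv (Z 0)) (g 0) \<noteq> 0"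
  shows "CM_germ g"
proof -
  obtain d where d: "\<And>t. degree (Z t) \<le> d" and CM: "\<And>j. CM_germ (\<lambda>t. coeff (Z t) j)"
    using Z by (auto simp: CM_poly_def)
  define a where "a j t = coeff (Z t) j" for j t
  define h where "h t = (\<Sum>i\<le>d. a i t * (of_nat i * g t ^ (i - 1)))" for t
  define w where "w t = inverse (h t)" for t
  have h_eq: "h t = poly (pderiv (Z t)) (g t)" for t
    unfolding h_def a_def by (rule poly_eq_sum_le(2)[OF d, symmetric])
  have h: "smooth_germ h"
    unfolding h_eq[abs_def] by (intro smooth_germ_poly CM_poly_pderiv Z g)
  have "(h \<longlongrightarrow> h 0) (nhds 0)" "(g \<longlongrightarrow> g 0) (nhds 0)"
    using h g by (auto simp: tendsto_at_iff_tendsto_nhds[symmetric] isCont_def[symmetric]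
        intro: smooth_germ_isCont)
  \<comment> \<open>These bounds keep both unknowns \<open>g\<close> and \<open>w = 1 / h\<close>
    bounded, as \<open>polynomial_ode_CM\<close> requires.\<close>
  then have "\<forall>\<^sub>F t in nhds 0. norm (h t) > norm (h 0) / 2" "\<forall>\<^sub>F t in nhds 0. norm (g t) < norm (g 0) + 1"
    using order_tendstoD(1)[OF tendsto_norm, of h "h 0" "nhds 0" "norm (h 0) / 2"]
      order_tendstoD(2)[OF tendsto_norm, of g "g 0" "nhds 0" "norm (g 0) + 1"] simple
    by (auto simp: h_eq)
  then have "\<forall>\<^sub>F t in nhds 0. norm (h t) > norm (h 0) / 2 \<and> norm (g t) < norm (g 0) + 1 \<and> poly (Z t) (g t) = 0"
    using zero by eventually_elim simp
  note ev = eventually_ball_at_right_0[OF this]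
  have "\<forall>\<^sub>F \<delta> in at_right 0. \<forall>j\<in>{..d}. CM_curve_on (ball 0 \<delta>) (a j)"
    using CM unfolding CM_germ_def a_def by (intro eventually_ball_finite) auto
  moreover have "\<forall>\<^sub>F \<delta> in at_right 0. smooth_curve_on (ball 0 \<delta>) g"
    using g by (simp add: smooth_germ_def)
  ultimately have "\<forall>\<^sub>F \<delta> in at_right 0. (\<forall>j\<in>{..d}. CM_curve_on (ball 0 \<delta>) (a j)) \<and>
      smooth_curve_on (ball 0 \<delta>) g \<and>
      (\<forall>t\<in>ball 0 \<delta>. norm (h t) > norm (h 0) / 2 \<and> norm (g t) < norm (g 0) + 1 \<and> poly (Z t) (g t) = 0)"
    using ev by eventually_elim blast
  then obtain \<delta> where \<delta>: "\<delta> > 0"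
    and aCM: "\<And>j. j \<le> d \<Longrightarrow> CM_curve_on (ball 0 \<delta>) (a j)"
    and gs: "smooth_curve_on (ball 0 \<delta>) g"
    and hb: "\<And>t. t \<in> ball 0 \<delta> \<Longrightarrow> norm (h t) > norm (h 0) / 2"
    and gb: "\<And>t. t \<in> ball 0 \<delta> \<Longrightarrow> norm (g t) < norm (g 0) + 1"
    and Z0: "\<And>t. t \<in> ball 0 \<delta> \<Longrightarrow> poly (Z t) (g t) = 0"
    by (rule eventually_at_right_0_obtain) auto
  define U where "U = ball (0::real) \<delta>"
  have U: "open U" by (simp add: U_def)
  have hn0: "h t \<noteq> 0" if "t \<in> U" for t
    using hb[of t] that by (auto simp: U_def)
  let ?C = "Collect (CM_curve_on U)"
  have const: "(\<lambda>t. c) \<in> ?C" for c using CM_curve_on_const[OF U] by simp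
  have ga: "a j \<in> gen_alg (S \<union> ?C)" if "j \<le> d" for j S
    using aCM[OF that] by (auto simp: U_def intro: gen_alg.base)
  have hA: "h \<in> gen_alg ({g} \<union> ?C)"
    unfolding h_def[abs_def]
    by (intro gen_alg_sum gen_alg.mult gen_alg_power ga)
      (use const in \<open>auto intro: gen_alg.base\<close>)
  \<comment> \<open>Implicit differentiation of \<open>poly (Z t) (g t) = 0\<close>, with
    \<open>w\<close> in place of the reciprocal of \<open>h\<close>.\<close>
  define G where "G t = - 1 * w t * (\<Sum>j\<le>d. ndv (Suc 0) (a j) t * g t ^ j)" for t
  have GA: "G \<in> gen_alg ({g, w} \<union> ?C)"
    unfolding G_def[abs_def]
    by (intro gen_alg_sum gen_alg.mult gen_alg_power)
      (use const CM_curve_on_ndv[OF aCM] in \<open>auto intro!: gen_alg.base simp: U_def\<close>)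
  have gd: "(g has_vector_derivative G t) (at t)" if t: "t \<in> U" for t
  proof -
    let ?g' = "ndv (Suc 0) g t"
    have g': "(g has_vector_derivative ?g') (at t)"
      using smooth_curve_onD[OF gs, of t 0] t by (simp add: U_def)
    have aj: "(a j has_vector_derivative ndv (Suc 0) (a j) t) (at t)" if "j \<le> d" for j
      using smooth_curve_onD[OF CM_curve_on_smooth[OF aCM[OF that]], of t 0] t by (simp add: U_def)
    have pw: "((\<lambda>t. g t ^ j) has_vector_derivative ?g' * (of_nat j * g t ^ (j - 1))) (at t)" for j
    proof -
      have "((\<lambda>z. z ^ j) has_field_derivative of_nat j * g t ^ (j - 1)) (at (g t))"
        by (auto intro!: derivative_eq_intros)
      from field_vector_diff_chain_at[OF g' this] show ?thesis by (simp add: o_def)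
    qed
    have "((\<lambda>t. \<Sum>j\<le>d. a j t * g t ^ j) has_vector_derivative
        (\<Sum>j\<le>d. a j t * (?g' * (of_nat j * g t ^ (j - 1))) + ndv (Suc 0) (a j) t * g t ^ j)) (at t)"
      by (intro has_vector_derivative_sum has_vector_derivative_mult aj pw) auto
    moreover have "((\<lambda>t. \<Sum>j\<le>d. a j t * g t ^ j) has_vector_derivative 0) (at t)"
    proof (rule has_vector_derivative_transform_within_open[OF has_vector_derivative_const U t])
      fix s assume "s \<in> U"
      then show "0 = (\<Sum>j\<le>d. a j s * g s ^ j)"
        using Z0[of s] by (simp add: U_def a_def poly_eq_sum_le(1)[OF d])
    qed
    ultimately have "(\<Sum>j\<le>d. a j t * (?g' * (of_nat j * g t ^ (j - 1))) + ndv (Suc 0) (a j) t * g t ^ j) = 0"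
      by (rule vector_derivative_unique_at)
    then have "?g' * h t = - (\<Sum>j\<le>d. ndv (Suc 0) (a j) t * g t ^ j)"
      by (simp add: h_def sum.distrib sum_distrib_left mult_ac eq_neg_iff_add_eq_0)
    then have "?g' = G t"
      using hn0[OF t] by (simp add: G_def w_def field_simps)
    then show ?thesis using g' by simp
  qed
  \<comment> \<open>\<open>h\<close> is built from \<open>g\<close> alone, but its derivative
    involves that of \<open>g\<close> and therefore \<open>w\<close>.\<close>
  have ST: "{g} \<union> ?C \<subseteq> {g, w} \<union> ?C" by auto
  have dS: "\<exists>f'\<in>gen_alg ({g, w} \<union> ?C). \<forall>t\<in>U. (f has_vector_derivative f' t) (at t)"
    if "f \<in> {g} \<union> ?C" for f
    using that GA gd CM_curve_on_derivative[of U f "{g, w}"] by auto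
  obtain h' where h': "h' \<in> gen_alg ({g, w} \<union> ?C)" "\<And>t. t \<in> U \<Longrightarrow> (h has_vector_derivative h' t) (at t)"
    using gen_alg_has_derivative(2)[OF ST dS hA] by blast
  have wd: "(w has_vector_derivative - 1 * w t * w t * h' t) (at t)" if t: "t \<in> U" for t
  proof -
    have "(inverse has_field_derivative - (inverse (h t) ^ Suc (Suc 0))) (at (h t))"
      by (rule DERIV_inverse[OF hn0[OF t]])
    from field_vector_diff_chain_at[OF h'(2)[OF t] this] show ?thesis
      by (simp add: o_def w_def[abs_def] mult_ac)
  qed
  have wA: "(\<lambda>t. - 1 * w t * w t * h' t) \<in> gen_alg ({g, w} \<union> ?C)"
    by (intro gen_alg.mult h') (use const in \<open>auto intro: gen_alg.base\<close>)
  have "CM_curve_on U g"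
  proof (rule polynomial_ode_CM[OF U, of "{g, w}"])
    fix f assume f: "f \<in> {g, w}"
    have "norm (w t) \<le> inverse (norm (h 0) / 2)" if "t \<in> U" for t
      using hb[of t] that simple unfolding w_def norm_inverse U_def
      by (intro le_imp_inverse_le) (auto simp: h_eq)
    then have "\<exists>C. \<forall>t\<in>U. norm (w t) \<le> C" by blast
    moreover have "\<exists>C. \<forall>t\<in>U. norm (g t) \<le> C"
      unfolding U_def using gb less_imp_le by blast
    ultimately show "\<exists>C. \<forall>t\<in>U. norm (f t) \<le> C" using f by auto
    show "\<exists>f'\<in>gen_alg ({g, w} \<union> ?C). \<forall>t\<in>U. (f has_vector_derivative f' t) (at t)"
    proof (cases "f = g")
      case True
      then show ?thesis using GA gd by (intro bexI[of _ G]) auto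
    next
      case False
      then have "f = w" using f by simp
      then show ?thesis using wA wd by (intro bexI[of _ "\<lambda>t. - 1 * w t * w t * h' t"]) auto
    qed
  qed auto
  then show ?thesis using \<delta> unfolding U_def by (rule CM_germI[rotated])
qed

text \<open>Repeated Hadamard quotients peel off one Taylor coefficient at a time. \<open>p\<close>
  is built from constants and powers of \<open>t\<close>, hence lies in the class, while
  \<open>g\<close> is merely smooth.\<close>

lemma smooth_germ_Taylor:
  assumes "smooth_germ f"
  shows "\<exists>p g. CM_germ p \<and> smooth_germ g \<and> (\<forall>\<^sub>F t in nhds 0. f t = p t + of_real t ^ n * g t)"
proof (induction n)
  case 0
  then show ?case using assms by (intro exI[of _ "\<lambda>t. 0"] exI[of _ f]) auto
next
  case (Suc n)
  then obtain p g where p: "CM_germ p" "smooth_germ g" "\<forall>\<^sub>F t in nhds 0. f t = p t + of_real t ^ n * g t"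
    by blast
  have "\<forall>\<^sub>F t in nhds 0. f t = (p t + of_real t ^ n * g 0) + of_real t ^ Suc n * hquot g t"
    using p(3) smooth_germ_hquot(2)[OF p(2)]
  proof eventually_elim
    case (elim t)
    show ?case unfolding elim(1) by (subst elim(2)) (simp add: algebra_simps)
  qed
  moreover have "CM_germ (\<lambda>t. p t + of_real t ^ n * g 0)"
    by (intro CM_germ_add CM_germ_mult CM_germ_power CM_germ_of_real CM_germ_const p)
  ultimately show ?case using smooth_germ_hquot(1)[OF p(2)] by blast
qed

text \<open>Newton's shift: if \<open>\<partial>\<^sub>yQ(t, f)\<close> vanishes to order \<open>r\<close>, write \<open>f = p + t\<^sup>r\<^sup>+\<^sup>1 g\<close> with a Taylor
  polynomial \<open>p\<close>; dividing \<open>Q(t, p + t\<^sup>r\<^sup>+\<^sup>1 y)\<close> by \<open>t\<^sup>2\<^sup>r\<^sup>+\<^sup>1\<close> yields a polynomial over the class with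
  simple root \<open>g\<close>.\<close>

lemma smooth_root_CM:
  assumes Q: "CM_poly Q" and f: "smooth_germ f"
    and zero: "\<forall>\<^sub>F t in nhds 0. poly (Q t) (f t) = 0"
    and nonflat: "\<not> flat_at_0 (\<lambda>t. poly (pderiv (Q t)) (f t))"
  shows "CM_germ f"
proof -
  obtain r u where u: "smooth_germ u" "u 0 \<noteq> 0"
    "\<forall>\<^sub>F t in nhds 0. poly (pderiv (Q t)) (f t) = of_real t ^ r * u t"
    using smooth_germ_factor[OF smooth_germ_poly[OF CM_poly_pderiv[OF Q] f] nonflat] by blast
  obtain p g where p: "CM_germ p" and g: "smooth_germ g"
    and fpg: "\<forall>\<^sub>F t in nhds 0. f t = p t + of_real t ^ Suc r * g t"
    using smooth_germ_Taylor[OF f, of "Suc r"] by blast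
  define s where "s t = of_real t ^ Suc r * g t" for t
  have s: "smooth_germ s"
    unfolding s_def[abs_def] by (intro smooth_germ_mult smooth_germ_power smooth_germ_of_real g)
  define V where "V t = pcompose (Q t) [:p t, 1:]" for t
  have V: "CM_poly V" unfolding V_def[abs_def] by (rule CM_poly_translate[OF Q p])
  define V1 where "V1 t = poly_shift 1 (V t)" for t
  define V2 where "V2 t = poly_shift 1 (V1 t)" for t
  define V3 where "V3 t = poly_shift 1 (pderiv (V t))" for t
  have V1: "CM_poly V1" unfolding V1_def[abs_def] by (rule CM_poly_shift[OF V])
  have V2: "CM_poly V2" unfolding V2_def[abs_def] by (rule CM_poly_shift[OF V1])
  have V3: "CM_poly V3" unfolding V3_def[abs_def] by (rule CM_poly_shift[OF CM_poly_pderiv[OF V]])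
  define v0 where "v0 t = coeff (V t) 0" for t
  define v1 where "v1 t = coeff (V t) 1" for t
  have v: "CM_germ v0" "CM_germ v1" using V by (auto simp: CM_poly_def v0_def[abs_def] v1_def[abs_def])
  have Veq: "poly (Q t) (p t + y) = v0 t + y * (v1 t + y * poly (V2 t) y)" for t y
    unfolding v0_def v1_def V2_def V1_def
    using poly_shift_Suc_0[of "V t" y] poly_shift_Suc_0[of "poly_shift 1 (V t)" y]
    by (simp add: V_def poly_pcompose coeff_poly_shift)
  have Veq': "poly (pderiv (Q t)) (p t + y) = v1 t + y * poly (V3 t) y" for t y
  proof -
    have "poly (pderiv (V t)) y = poly (pderiv (Q t)) (p t + y)"
      by (simp add: V_def pderiv_pcompose poly_pcompose pderiv_pCons)
    then show ?thesis
      using poly_shift_Suc_0[of "pderiv (V t)" y] by (simp add: V3_def v1_def coeff_pderiv)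
  qed
  \<comment> \<open>The derivative at \<open>p\<close> differs from that at \<open>f\<close> by a
    multiple of \<open>s\<close>, which vanishes to order \<open>r + 1\<close>. So \<open>v1\<close>
    has the same order \<open>r\<close>, and \<open>u1 0 = u 0\<close>.\<close>
  define u1 where "u1 t = u t + (- 1) * (of_real t * (g t * poly (V3 t) (s t)))" for t
  have u1s: "smooth_germ u1" unfolding u1_def[abs_def]
    by (intro smooth_germ_add smooth_germ_mult smooth_germ_const smooth_germ_of_real
        smooth_germ_poly u g s V3)
  have ev1: "\<forall>\<^sub>F t in nhds 0. v1 t = of_real t ^ r * u1 t"
    using u(3) fpg
  proof eventually_elim
    case (elim t)
    then have "of_real t ^ r * u t = v1 t + s t * poly (V3 t) (s t)"
      using Veq'[of t "s t"] by (simp add: s_def)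
    moreover have "s t * poly (V3 t) (s t) = of_real t ^ r * (of_real t * (g t * poly (V3 t) (s t)))"
      by (subst s_def) (simp add: mult_ac)
    ultimately show ?case by (simp add: u1_def algebra_simps)
  qed
  \<comment> \<open>\<open>v1\<close> is a coefficient of \<open>V\<close> and so in the class;
    division carries this over to \<open>u1\<close>, although \<open>u1\<close> was built from
    merely smooth germs.\<close>
  have u1: "CM_germ u1" by (rule CM_germ_divide_power[OF v(2) u1s ev1])
  define w0 where "w0 t = (- 1) * (u1 t * g t + of_real t * (g t * (g t * poly (V2 t) (s t))))" for t
  have w0s: "smooth_germ w0" unfolding w0_def[abs_def]
    by (intro smooth_germ_add smooth_germ_mult smooth_germ_const smooth_germ_of_real
        smooth_germ_poly u1s g s V2)
  have "\<forall>\<^sub>F t in nhds 0. v0 t = of_real t ^ (r + Suc r) * w0 t"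
    using ev1 fpg zero
  proof eventually_elim
    case (elim t)
    then have "v0 t + s t * (v1 t + s t * poly (V2 t) (s t)) = 0"
      using Veq[of t "s t"] by (simp add: s_def)
    then have "v0 t = - (s t * (v1 t + s t * poly (V2 t) (s t)))"
      by (simp add: eq_neg_iff_add_eq_0)
    also have "\<dots> = - (of_real t ^ Suc r * g t *
        (of_real t ^ r * u1 t + of_real t ^ Suc r * g t * poly (V2 t) (s t)))"
      unfolding elim(1) s_def[of t] by (simp only:)
    also have "\<dots> = of_real t ^ (r + Suc r) * w0 t"
      by (simp add: w0_def power_add algebra_simps)
    finally show ?case .
  qed
  then have w0: "CM_germ w0" by (rule CM_germ_divide_power[OF v(1) w0s])
  \<comment> \<open>The expansion of \<open>V\<close> at \<open>t ^ Suc r * y\<close>, divided by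
    \<open>t ^ (2 * r + 1)\<close>. The terms of degree at least two in \<open>y\<close> keep a
    factor \<open>t\<close>, so at \<open>t = 0\<close> the derivative in \<open>y\<close> is
    \<open>u1 0\<close>.\<close>
  define Z where
    "Z t = pCons (w0 t) (pCons (u1 t) (smult (of_real t) (pcompose (V2 t) [:0, of_real t ^ Suc r:])))" for t
  have "CM_poly Z" unfolding Z_def[abs_def]
    by (intro CM_poly_pCons CM_poly_smult CM_poly_scale CM_germ_power CM_germ_of_real w0 u1 V2)
  moreover have "poly (Z t) (g t) = 0" for t
    by (simp add: Z_def w0_def poly_pcompose s_def algebra_simps)
  moreover have "poly (pderiv (Z 0)) (g 0) \<noteq> 0"
    using u(2) by (simp add: Z_def u1_def pderiv_pCons)
  ultimately have "CM_germ g" using g by (intro simple_root_CM[of Z]) auto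
  then have "CM_germ (\<lambda>t. p t + of_real t ^ Suc r * g t)"
    by (intro CM_germ_add CM_germ_mult CM_germ_power CM_germ_of_real p)
  then show ?thesis
    by (rule CM_germ_cong) (use fpg in eventually_elim, simp)
qed

end

section \<open>Comparison with componentwise real derivatives\<close>

lemma deriv_jet:
  assumes U: "open U" and D0: "\<And>t. t \<in> U \<Longrightarrow> D 0 t = f t"
    and D: "\<And>k t. t \<in> U \<Longrightarrow> (D k has_real_derivative D (Suc k) t) (at t)"
  shows "\<And>k t. t \<in> U \<Longrightarrow> (deriv ^^ k) f t = D k t" and "C_inf_on U f"
proof -
  have step: "((deriv ^^ k) f has_real_derivative D (Suc k) t) (at t)"
    if eq: "\<forall>t\<in>U. (deriv ^^ k) f t = D k t" and t: "t \<in> U" for k t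
    by (rule has_field_derivative_transform_within_open[OF D[OF t] U t]) (use eq in auto)
  have *: "\<forall>t\<in>U. (deriv ^^ k) f t = D k t" for k
  proof (induction k)
    case (Suc k)
    then show ?case using step by (auto intro!: DERIV_imp_deriv)
  qed (simp add: D0)
  then show "\<And>k t. t \<in> U \<Longrightarrow> (deriv ^^ k) f t = D k t" by blast
  show "C_inf_on U f"
    unfolding C_inf_on_def using step * real_differentiable_def by blast
qed

lemma C_inf_on_smooth_curve:
  assumes U: "open U" and re: "C_inf_on U (\<lambda>t. Re (f t))" and im: "C_inf_on U (\<lambda>t. Im (f t))"
  shows "smooth_curve_on U f"
    and "\<And>k t. t \<in> U \<Longrightarrow>
      ndv k f t = Complex ((deriv ^^ k) (\<lambda>t. Re (f t)) t) ((deriv ^^ k) (\<lambda>t. Im (f t)) t)"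
proof -
  let ?D = "\<lambda>k t. Complex ((deriv ^^ k) (\<lambda>t. Re (f t)) t) ((deriv ^^ k) (\<lambda>t. Im (f t)) t)"
  have d: "(?D k has_vector_derivative ?D (Suc k) t) (at t)" if "t \<in> U" for k t
    using re im that
    by (auto simp: has_vector_derivative_complex_iff C_inf_on_def DERIV_deriv_iff_real_differentiable)
  note j = ndv_jet[of U ?D f, OF U _ d]
  show "smooth_curve_on U f" by (rule j) auto
  show "\<And>k t. t \<in> U \<Longrightarrow> ndv k f t = ?D k t" by (rule j) auto
qed

context dc_weight
begin

text \<open>The closed ball of half the radius is compact and supplies one pair of
  constants.\<close>

lemma CM_on_imp_CM_germ:
  assumes "\<epsilon> > 0" and re: "CM_on M (ball 0 \<epsilon>) (\<lambda>t. Re (f t))" and im: "CM_on M (ball 0 \<epsilon>) (\<lambda>t. Im (f t))"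
  shows "CM_germ f"
proof (rule CM_germI)
  let ?U = "ball (0::real) (\<epsilon> / 2)"
  show "\<epsilon> / 2 > 0" using assms by simp
  have K: "compact (cball (0::real) (\<epsilon> / 2)) \<and> cball (0::real) (\<epsilon> / 2) \<subseteq> ball 0 \<epsilon>"
    using \<open>\<epsilon> > 0\<close> by auto
  have "C_inf_on (ball 0 \<epsilon>) (\<lambda>t. Re (f t))" "C_inf_on (ball 0 \<epsilon>) (\<lambda>t. Im (f t))"
    using re im by (auto simp: CM_on_def)
  note sm = C_inf_on_smooth_curve(1)[OF open_ball this] and nd = C_inf_on_smooth_curve(2)[OF open_ball this]
  from re[unfolded CM_on_def, THEN conjunct2, THEN spec, THEN mp, OF K]
  obtain C1 \<rho>1 where 1: "C1 > 0" "\<rho>1 > 0"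
    "\<And>k t. t \<in> cball 0 (\<epsilon> / 2) \<Longrightarrow> \<bar>(deriv ^^ k) (\<lambda>t. Re (f t)) t\<bar> \<le> C1 * \<rho>1 ^ k * fact k * M k"
    by blast
  from im[unfolded CM_on_def, THEN conjunct2, THEN spec, THEN mp, OF K]
  obtain C2 \<rho>2 where 2: "C2 > 0" "\<rho>2 > 0"
    "\<And>k t. t \<in> cball 0 (\<epsilon> / 2) \<Longrightarrow> \<bar>(deriv ^^ k) (\<lambda>t. Im (f t)) t\<bar> \<le> C2 * \<rho>2 ^ k * fact k * M k"
    by blast
  have "norm (ndv k f t) \<le> (C1 + C2) * max \<rho>1 \<rho>2 ^ k * fact k * M k" if t: "t \<in> ?U" for k t
  proof -
    have t': "t \<in> cball 0 (\<epsilon> / 2)" "t \<in> ball 0 \<epsilon>" using t \<open>\<epsilon> > 0\<close> by auto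
    have "norm (ndv k f t) \<le> \<bar>Re (ndv k f t)\<bar> + \<bar>Im (ndv k f t)\<bar>" by (rule cmod_le)
    also have "\<dots> \<le> C1 * \<rho>1 ^ k * fact k * M k + C2 * \<rho>2 ^ k * fact k * M k"
      using 1(3)[OF t'(1), of k] 2(3)[OF t'(1), of k] by (simp add: nd[OF t'(2)])
    also have "\<dots> \<le> C1 * max \<rho>1 \<rho>2 ^ k * fact k * M k + C2 * max \<rho>1 \<rho>2 ^ k * fact k * M k"
      using 1(1,2) 2(1,2) by (intro add_mono mult_right_mono mult_left_mono power_mono) auto
    finally show ?thesis by (simp add: algebra_simps)
  qed
  moreover have "smooth_curve_on ?U f"
    using sm by (rule smooth_curve_on_subset) (use \<open>\<epsilon> > 0\<close> in auto)
  ultimately show "CM_curve_on ?U f"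
    unfolding CM_curve_on_def using 1(1,2) 2(1,2)
    by (intro conjI exI[of _ "C1 + C2"] exI[of _ "max \<rho>1 \<rho>2"]) auto
qed

lemma CM_curve_on_imp_CM_on:
  assumes U: "open U" and f: "CM_curve_on U f"
  shows "CM_on M U (\<lambda>t. Re (f t))" and "CM_on M U (\<lambda>t. Im (f t))"
proof -
  obtain C \<rho> where C: "C > 0" "\<rho> > 0" "\<And>k t. t \<in> U \<Longrightarrow> norm (ndv k f t) \<le> C * \<rho> ^ k * fact k * M k"
    using f by (auto simp: CM_curve_on_def)
  have *: "CM_on M U g"
    if D0: "\<And>t. t \<in> U \<Longrightarrow> D 0 t = g t" and D: "\<And>k t. t \<in> U \<Longrightarrow> (D k has_real_derivative D (Suc k) t) (at t)"
      and le: "\<And>k t. \<bar>D k t\<bar> \<le> norm (ndv k f t)" for D g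
  proof -
    have "\<bar>(deriv ^^ k) g t\<bar> \<le> C * \<rho> ^ k * fact k * M k" if "t \<in> U" for k t
      using le[of k t] C(3)[OF that, of k] deriv_jet(1)[of U D g, OF U D0 D that, of k] by simp
    moreover have "C_inf_on U g" using deriv_jet(2)[of U D g, OF U D0 D] by blast
    ultimately show ?thesis unfolding CM_on_def using C(1,2) by blast
  qed
  note d = smooth_curve_onD[OF CM_curve_on_smooth[OF f]]
  show "CM_on M U (\<lambda>t. Re (f t))"
    using d by (intro *[of "\<lambda>k t. Re (ndv k f t)"])
      (auto simp: has_vector_derivative_complex_iff abs_Re_le_cmod)
  show "CM_on M U (\<lambda>t. Im (f t))"
    using d by (intro *[of "\<lambda>k t. Im (ndv k f t)"])
      (auto simp: has_vector_derivative_complex_iff abs_Im_le_cmod)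
qed

lemma CM_germ_flat_imp_zero:
  assumes "quasianalytic M" "CM_germ f" "flat_at_0 f"
  shows "\<forall>\<^sub>F t in nhds 0. f t = 0"
proof -
  obtain d where "d > 0" "CM_curve_on (ball 0 d) f"
    using assms(2) unfolding CM_germ_def by (rule eventually_at_right_0_obtain)
  then show ?thesis
    using Denjoy_Carleman[OF assms(1)] assms(3) unfolding eventually_nhds_metric flat_at_0_def
    by (intro exI[of _ d]) (auto simp: dist_commute)
qed

end

section \<open>Orbit polynomials\<close>

lemma polyfun_sum:
  "(\<And>i. i \<in> I \<Longrightarrow> polyfun (f i)) \<Longrightarrow> polyfun (\<lambda>x. \<Sum>i\<in>I. f i x)"
  by (induction I rule: infinite_finite_induct) (auto intro: polyfun.intros)

lemma polyfun_power: "polyfun f \<Longrightarrow> polyfun (\<lambda>x. f x ^ n)"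
  by (induction n) (auto intro: polyfun.intros)

lemma polyfun_poly:
  fixes W :: "complex^'k \<Rightarrow> complex poly"
  assumes "\<And>j. polyfun (\<lambda>x. coeff (W x) j)" "\<And>x. degree (W x) \<le> d" "polyfun f"
  shows "polyfun (\<lambda>x. poly (W x) (f x))"
  unfolding poly_eq_sum_le(1)[OF assms(2)]
  by (intro polyfun_sum polyfun.mult polyfun_power assms)

lemma polyfun_coeff_prod:
  assumes "finite A" "\<And>g. g \<in> A \<Longrightarrow> polyfun (F g)"
  shows "polyfun (\<lambda>x. coeff (\<Prod>g\<in>A. [:- F g x, 1:]) j)"
  using assms
proof (induction A arbitrary: j rule: finite_induct)
  case empty
  then show ?case by (auto intro: polyfun.intros)
next
  case (insert g A)
  have "coeff (\<Prod>g\<in>insert g A. [:- F g x, 1:]) j = - 1 * F g x * coeff (\<Prod>g\<in>A. [:- F g x, 1:]) j +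
      (case j of 0 \<Rightarrow> 0 | Suc i \<Rightarrow> coeff (\<Prod>g\<in>A. [:- F g x, 1:]) i)" for x
    using insert.hyps by (simp add: coeff_pCons split: nat.splits)
  moreover have "polyfun (\<lambda>x. case j of 0 \<Rightarrow> 0 | Suc i \<Rightarrow> coeff (\<Prod>g\<in>A. [:- F g x, 1:]) i)"
    using insert by (cases j) (auto intro: polyfun.intros)
  ultimately show ?case
    using insert by (simp only:) (intro polyfun.intros; simp)
qed

lemma monic_prod_linear:
  assumes "finite A"
  shows "degree (\<Prod>g\<in>A. [:- a g, 1 :: complex:]) = card A"
    and "coeff (\<Prod>g\<in>A. [:- a g, 1 :: complex:]) (card A) = 1"
proof -
  show *: "degree (\<Prod>g\<in>A. [:- a g, 1 :: complex:]) = card A"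
    by (subst degree_prod_eq_sum_degree) auto
  have "lead_coeff (\<Prod>g\<in>A. [:- a g, 1 :: complex:]) = 1"
    by (simp add: lead_coeff_prod)
  then show "coeff (\<Prod>g\<in>A. [:- a g, 1 :: complex:]) (card A) = 1" by (simp only: *)
qed

lemma poly_higher_pderiv_monic:
  fixes p :: "complex poly"
  assumes "degree p = m" "coeff p m = 1"
  shows "poly ((pderiv ^^ m) p) x = fact m"
proof -
  have "(pderiv ^^ m) p = [:fact m:]"
  proof (rule poly_eqI)
    fix n
    show "coeff ((pderiv ^^ m) p) n = coeff [:fact m:] n"
      using assms by (cases n) (auto simp: coeff_higher_pderiv pochhammer_fact coeff_eq_0)
  qed
  then show ?thesis by simp
qed

lemma poly_shift_low_zero:
  fixes p :: "'a :: comm_semiring_1 poly"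
  assumes "\<And>j. j < k \<Longrightarrow> coeff p j = 0"
  shows "poly p x = x ^ k * poly (poly_shift k p) x"
proof -
  have "p = monom 1 k * poly_shift k p"
    by (rule poly_eqI) (use assms in \<open>auto simp: coeff_monom_mult coeff_poly_shift\<close>)
  then show ?thesis by (metis mult_1 poly_monom poly_mult)
qed

locale lifted_curve = dc_weight M
  for M :: "nat \<Rightarrow> real" +
  fixes G :: "('g, 'b) monoid_scheme"
    and rho :: "'g \<Rightarrow> complex^'d \<Rightarrow> complex^'d"
    and sg :: "'n::finite \<Rightarrow> complex^'d \<Rightarrow> complex"
    and c :: "real \<Rightarrow> complex^'n"
    and cbar :: "real \<Rightarrow> complex^'d"
    and \<epsilon> :: real
  assumes lin: "linear_action G rho" and fin: "finite (carrier G)"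
    and gens: "homogeneous_generators G rho sg"
    and qa: "quasianalytic M"
    and eps: "\<epsilon> > 0"
    and c_CM: "CM_on_vec M (ball 0 \<epsilon>) c"
    and cbar_smooth: "C_inf_on_vec (ball 0 \<epsilon>) cbar"
    and lift: "\<forall>t\<in>ball 0 \<epsilon>. orbit_map sg (cbar t) = c t"
begin

lemma smooth_germ_polyfun:
  assumes "polyfun f"
  shows "smooth_germ (\<lambda>t. f (cbar t))"
  using assms
proof induction
  case (coord i)
  have "smooth_curve_on (ball 0 \<epsilon>) (\<lambda>t. cbar t $ i)"
    using cbar_smooth by (intro C_inf_on_smooth_curve) (auto simp: C_inf_on_vec_def)
  then show ?case using eps by (rule smooth_germI[rotated])
qed (auto intro: smooth_germ_add smooth_germ_mult)

lemma CM_germ_polyfun: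
  assumes "polyfun f"
  shows "CM_germ (\<lambda>t. f (c t))"
  using assms
proof induction
  case (coord i)
  show ?case using c_CM by (intro CM_on_imp_CM_germ[OF eps]) (auto simp: CM_on_vec_def)
qed (auto intro: CM_germ_add CM_germ_mult)

text \<open>An invariant is a polynomial in the generators, so along \<open>cbar\<close> it is a
  polynomial in the components of \<open>c\<close>. Only here does regularity pass from
  \<open>c\<close> to \<open>cbar\<close>.\<close>

lemma CM_germ_invariant:
  assumes "polyfun f" "invariant_fun G rho f"
  shows "CM_germ (\<lambda>t. f (cbar t))"
proof -
  obtain P where P: "polyfun P" "\<And>x. f x = P (orbit_map sg x)"
    using gens assms by (auto simp: homogeneous_generators_def orbit_map_def)
  show ?thesis
  proof (rule CM_germ_cong[OF CM_germ_polyfun[OF P(1)]])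
    show "\<forall>\<^sub>F t in nhds 0. P (c t) = f (cbar t)"
      using eps lift unfolding eventually_nhds_metric
      by (intro exI[of _ \<epsilon>]) (auto simp: P(2) dist_commute)
  qed
qed

lemma group_G: "group G" and rho_one: "rho \<one>\<^bsub>G\<^esub> = id"
  and rho_add: "g \<in> carrier G \<Longrightarrow> rho g (x + y) = rho g x + rho g y"
  and rho_scale: "g \<in> carrier G \<Longrightarrow> rho g (a *s x) = a *s rho g x"
  and rho_mult: "g \<in> carrier G \<Longrightarrow> h \<in> carrier G \<Longrightarrow> rho g (rho h x) = rho (g \<otimes>\<^bsub>G\<^esub> h) x"
  using lin by (auto simp: linear_action_def)

lemma polyfun_rho:
  assumes g: "g \<in> carrier G" and f: "polyfun f"
  shows "polyfun (\<lambda>x. f (rho g x))"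
  using f
proof induction
  case (coord i)
  have 0: "rho g 0 = 0" using rho_add[OF g, of 0 0] by simp
  have sum: "rho g (\<Sum>j\<in>J. h j) = (\<Sum>j\<in>J. rho g (h j))" for J and h :: "'d \<Rightarrow> complex^'d"
    by (induction J rule: infinite_finite_induct) (auto simp: 0 rho_add[OF g])
  have "rho g x $ i = (\<Sum>j\<in>UNIV. rho g (axis j 1) $ i * x $ j)" for x
  proof -
    have "rho g x = rho g (\<Sum>j\<in>UNIV. x $ j *s axis j 1)" by (simp add: basis_expansion)
    also have "\<dots> = (\<Sum>j\<in>UNIV. x $ j *s rho g (axis j 1))" by (simp add: sum rho_scale[OF g])
    finally show ?thesis by (simp add: mult.commute)
  qed
  then have eq: "(\<lambda>x. rho g x $ i) = (\<lambda>x. \<Sum>j\<in>UNIV. rho g (axis j 1) $ i * x $ j)" by (rule ext)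
  show ?case by (subst eq) (intro polyfun_sum polyfun.intros)
qed (auto intro: polyfun.intros)

text \<open>The product runs over group elements, not over distinct orbit points. The degree is thus
  constant and the coefficients, being symmetric in the translates of \<open>f\<close>, are
  polynomials on the whole space.\<close>

definition orbit_poly :: "(complex^'d \<Rightarrow> complex) \<Rightarrow> complex^'d \<Rightarrow> complex poly" where
  "orbit_poly f x = (\<Prod>g\<in>carrier G. [:- f (rho g x), 1:])"

lemma polyfun_orbit_poly: "polyfun f \<Longrightarrow> polyfun (\<lambda>x. coeff (orbit_poly f x) j)"
  unfolding orbit_poly_def by (intro polyfun_coeff_prod fin polyfun_rho)

text \<open>Right multiplication by \<open>h\<close> permutes the factors. This makes the
  coefficients invariant, hence germs of the class along \<open>cbar\<close>.\<close>

lemma orbit_poly_rho: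
  assumes h: "h \<in> carrier G"
  shows "orbit_poly f (rho h x) = orbit_poly f x"
proof -
  interpret group G by (rule group_G)
  show ?thesis
    unfolding orbit_poly_def
    by (rule prod.reindex_bij_witness[of _ "\<lambda>g. g \<otimes>\<^bsub>G\<^esub> inv\<^bsub>G\<^esub> h" "\<lambda>g. g \<otimes>\<^bsub>G\<^esub> h"])
      (use h in \<open>auto simp: rho_mult m_assoc\<close>)
qed

lemma orbit_poly_degree: "degree (orbit_poly f x) = card (carrier G)"
  and orbit_poly_monic: "coeff (orbit_poly f x) (card (carrier G)) = 1"
  unfolding orbit_poly_def by (rule monic_prod_linear[OF fin])+

lemma orbit_poly_root: "poly (orbit_poly f x) (f x) = 0"
proof -
  interpret group G by (rule group_G)
  have "\<exists>g\<in>carrier G. poly [:- f (rho g x), 1:] (f x) = 0"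
    by (rule bexI[of _ "\<one>\<^bsub>G\<^esub>"]) (auto simp: rho_one)
  then show ?thesis
    using fin by (simp add: orbit_poly_def poly_prod)
qed

lemma CM_poly_orbit_poly:
  assumes "polyfun f"
  shows "CM_poly (\<lambda>t. orbit_poly f (cbar t))"
proof -
  have "CM_germ (\<lambda>t. coeff (orbit_poly f (cbar t)) j)" for j
    by (rule CM_germ_invariant[OF polyfun_orbit_poly[OF assms]])
      (simp add: invariant_fun_def orbit_poly_rho)
  then show ?thesis by (auto simp: CM_poly_def orbit_poly_degree)
qed

text \<open>A flat \<open>h = f \<circ> cbar\<close> is a root of a monic polynomial over the class. Its lowest coefficient that
  is not the zero germ has finite order by quasianalyticity, which leaves \<open>h\<^sup>k\<close> times a
  function without zeros near \<open>0\<close>.\<close>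

lemma polyfun_flat_imp_zero:
  assumes f: "polyfun f" and flat: "flat_at_0 (\<lambda>t. f (cbar t))"
  shows "\<forall>\<^sub>F t in nhds 0. f (cbar t) = 0"
proof -
  define h where "h t = f (cbar t)" for t
  define Q where "Q t = orbit_poly f (cbar t)" for t
  have h: "smooth_germ h" unfolding h_def[abs_def] by (rule smooth_germ_polyfun[OF f])
  have hflat: "flat_at_0 h" using flat by (simp add: h_def[abs_def])
  have Q: "CM_poly Q" unfolding Q_def[abs_def] by (rule CM_poly_orbit_poly[OF f])
  have Qj: "CM_germ (\<lambda>t. coeff (Q t) j)" for j using Q by (simp add: CM_poly_def)
  have "\<exists>k. \<not> flat_at_0 (\<lambda>t. coeff (Q t) k)"
  proof
    show "\<not> flat_at_0 (\<lambda>t. coeff (Q t) (card (carrier G)))"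
      by (auto simp: Q_def orbit_poly_monic flat_at_0_def intro!: exI[of _ 0])
  qed
  then obtain k where k: "\<not> flat_at_0 (\<lambda>t. coeff (Q t) k)"
    and less: "\<And>j. j < k \<Longrightarrow> flat_at_0 (\<lambda>t. coeff (Q t) j)"
    using exists_least_iff[of "\<lambda>k. \<not> flat_at_0 (\<lambda>t. coeff (Q t) k)"] by auto
  have "\<forall>j\<in>{..<k}. \<forall>\<^sub>F t in nhds 0. coeff (Q t) j = 0"
    using CM_germ_flat_imp_zero[OF qa Qj] less by auto
  then have low: "\<forall>\<^sub>F t in nhds 0. \<forall>j\<in>{..<k}. coeff (Q t) j = 0"
    by (rule eventually_ball_finite[OF finite_lessThan])
  define Q1 where "Q1 t = poly_shift k (Q t)" for t
  define Q2 where "Q2 t = poly_shift 1 (Q1 t)" for t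
  have Q1: "CM_poly Q1" unfolding Q1_def[abs_def] by (rule CM_poly_shift[OF Q])
  have Q2: "CM_poly Q2" unfolding Q2_def[abs_def] by (rule CM_poly_shift[OF Q1])
  define B where "B t = poly (Q1 t) (h t)" for t
  have B: "smooth_germ B" unfolding B_def[abs_def] by (rule smooth_germ_poly[OF Q1 h])
  have "\<not> flat_at_0 B"
  proof
    assume Bflat: "flat_at_0 B"
    have P: "smooth_germ (\<lambda>t. - 1 * poly (Q2 t) (h t))"
      by (intro smooth_germ_mult smooth_germ_const smooth_germ_poly[OF Q2 h])
    \<comment> \<open>\<open>R\<close> is what \<open>B\<close> lacks from the coefficient of index
      \<open>k\<close>. As a multiple of the flat \<open>h\<close> it is flat, so a flat
      \<open>B\<close> would make that coefficient flat.\<close>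
    define R where "R t = h t * (- 1 * poly (Q2 t) (h t))" for t
    have R: "smooth_germ R" "flat_at_0 R"
      unfolding R_def[abs_def]
      by (rule smooth_germ_mult[OF h P], rule flat_at_0_mult[OF h P hflat])
    have "coeff (Q t) k = B t + R t" for t
      using poly_shift_Suc_0[of "Q1 t" "h t"] by (simp add: B_def Q2_def Q1_def R_def coeff_poly_shift)
    moreover have "flat_at_0 (\<lambda>t. B t + R t)"
      using Bflat R(2) by (simp add: flat_at_0_def smooth_germ_add(2)[OF B R(1)])
    ultimately have "flat_at_0 (\<lambda>t. coeff (Q t) k)" by (simp only:)
    with k show False by simp
  qed
  then have "\<forall>\<^sub>F t in at 0. B t \<noteq> 0" by (rule not_flat_eventually_nonzero[OF B])
  moreover have "\<forall>\<^sub>F t in at 0. \<forall>j\<in>{..<k}. coeff (Q t) j = 0"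
    using low by (simp add: eventually_nhds_conv_at)
  ultimately have "\<forall>\<^sub>F t in at 0. h t = 0"
  proof eventually_elim
    case (elim t)
    have "h t ^ k * B t = 0"
      using poly_shift_low_zero[of k "Q t" "h t"] elim(2) orbit_poly_root[of f "cbar t"]
      by (simp add: B_def Q1_def Q_def h_def)
    then show ?case using elim(1) by simp
  qed
  then have "\<forall>\<^sub>F t in nhds 0. h t = 0"
    by (rule smooth_germ_eq_nhds[OF h smooth_germ_const])
  then show ?thesis by (simp add: h_def)
qed

text \<open>Let \<open>k\<close> be least with \<open>\<phi> k\<close> not flat along
  \<open>cbar\<close>; it exists because the \<open>m\<close>-th derivative of a monic polynomial of
  degree \<open>m\<close> is a non-zero constant. Each earlier \<open>\<phi> j\<close> is a
  polynomial on the whole space, so flatness forces it to vanish along \<open>cbar\<close>. Hence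
  the coordinate is a root of the derivative of order \<open>k - 1\<close>, whose own derivative
  there is not flat.\<close>

lemma CM_germ_coordinate: "CM_germ (\<lambda>t. cbar t $ i)"
proof -
  define m where "m = card (carrier G)"
  let ?x = "\<lambda>x :: complex^'d. x $ i"
  define Q where "Q k t = (pderiv ^^ k) (orbit_poly ?x (cbar t))" for k t
  define \<phi> where "\<phi> k x = poly ((pderiv ^^ k) (orbit_poly ?x x)) (x $ i)" for k x
  have x: "polyfun ?x" by (rule polyfun.coord)
  have \<phi>: "polyfun (\<phi> k)" for k
    unfolding \<phi>_def[abs_def]
  proof (rule polyfun_poly[OF _ _ x])
    show "polyfun (\<lambda>x. coeff ((pderiv ^^ k) (orbit_poly ?x x)) j)" for j
      unfolding coeff_higher_pderiv by (intro polyfun.mult polyfun.const polyfun_orbit_poly x)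
    show "degree ((pderiv ^^ k) (orbit_poly ?x x)) \<le> m" for x
      by (simp add: degree_higher_pderiv orbit_poly_degree m_def)
  qed
  have "\<exists>k. \<not> flat_at_0 (\<lambda>t. \<phi> k (cbar t))"
  proof
    show "\<not> flat_at_0 (\<lambda>t. \<phi> m (cbar t))"
      using poly_higher_pderiv_monic[OF orbit_poly_degree orbit_poly_monic]
      by (auto simp: \<phi>_def flat_at_0_def m_def intro!: exI[of _ 0])
  qed
  then obtain k where k: "\<not> flat_at_0 (\<lambda>t. \<phi> k (cbar t))"
    and less: "\<And>j. j < k \<Longrightarrow> flat_at_0 (\<lambda>t. \<phi> j (cbar t))"
    using exists_least_iff[of "\<lambda>k. \<not> flat_at_0 (\<lambda>t. \<phi> k (cbar t))"] by auto
  \<comment> \<open>This allows stepping back to order \<open>k - 1\<close>; the orbit polynomial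
    itself vanishes at the coordinate everywhere.\<close>
  have "k \<noteq> 0"
  proof
    assume "k = 0"
    moreover have "\<phi> 0 = (\<lambda>x. 0)"
      using orbit_poly_root[of ?x] by (simp add: \<phi>_def fun_eq_iff)
    ultimately show False
      using k smooth_curve_on_const(2)[OF open_UNIV, of 0 _ 0] by (simp add: flat_at_0_def)
  qed
  then obtain l where l: "k = Suc l" by (cases k) auto
  show ?thesis
  proof (rule smooth_root_CM)
    show "CM_poly (Q l)"
      unfolding Q_def[abs_def] by (induction l) (auto intro: CM_poly_orbit_poly[OF x] CM_poly_pderiv)
    show "smooth_germ (\<lambda>t. cbar t $ i)" by (rule smooth_germ_polyfun[OF x])
    show "\<forall>\<^sub>F t in nhds 0. poly (Q l t) (cbar t $ i) = 0"
      using polyfun_flat_imp_zero[OF \<phi> less, of l] l by (simp add: \<phi>_def Q_def)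
    show "\<not> flat_at_0 (\<lambda>t. poly (pderiv (Q l t)) (cbar t $ i))"
      using k by (simp add: \<phi>_def Q_def l)
  qed
qed

lemma cbar_CM: "\<exists>\<delta>>0. CM_on_vec M (ball 0 \<delta>) cbar"
proof -
  have "\<forall>\<^sub>F \<delta> in at_right 0. \<forall>i\<in>UNIV. CM_curve_on (ball 0 \<delta>) (\<lambda>t. cbar t $ i)"
    using CM_germ_coordinate unfolding CM_germ_def by (intro eventually_ball_finite) auto
  then obtain \<delta> where "\<delta> > 0" "\<And>i. CM_curve_on (ball 0 \<delta>) (\<lambda>t. cbar t $ i)"
    by (rule eventually_at_right_0_obtain) auto
  then show ?thesis
    unfolding CM_on_vec_def using CM_curve_on_imp_CM_on[OF open_ball] by blast
qed

end

theorem theorem7p1: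
  fixes G :: "('g, 'b) monoid_scheme"
    and rho :: "'g \<Rightarrow> complex^'d \<Rightarrow> complex^'d"
    and sg :: "'n::finite \<Rightarrow> complex^'d \<Rightarrow> complex"
    and M :: "nat \<Rightarrow> real"
    and c :: "real \<Rightarrow> complex^'n"
    and cbar :: "real \<Rightarrow> complex^'d"
    and \<epsilon> :: real
  assumes "linear_action G rho" and "finite (carrier G)"
    and "homogeneous_generators G rho sg"
    and "DC_weight_sequence M" and "quasianalytic M"
    and "\<epsilon> > 0"
    and "CM_on_vec M (ball 0 \<epsilon>) c"
    and "C_inf_on_vec (ball 0 \<epsilon>) cbar"
    and "\<forall>t\<in>ball 0 \<epsilon>. orbit_map sg (cbar t) = c t"
  shows "\<exists>\<delta>>0. CM_on_vec M (ball 0 \<delta>) cbar"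
proof -
  interpret lifted_curve M G rho sg c cbar \<epsilon>
    using assms by unfold_locales
  show ?thesis by (rule cbar_CM)
qed

end
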